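(* Let $X$ be a Banach space with property $( * )$ and $Y\subset X$ a closed linear subspace. Let $f:Y\to\mathbb{R}$ be $\mathcal{C}^1$-smooth and $F:X\to\mathbb{R}$ a continuous extension of $f$. Then for every $\varepsilon>0$ there is a $\mathcal{C}^1$-smooth $G:X\to\mathbb{R}$ such that, with $g=G|_Y$, (i) $|F(x)-G(x)|<\varepsilon$ for all $x\in X$, and (ii) $\|f'(y)-g'(y)\|_{Y^*}<\varepsilon$ for all $y\in Y$. (iii) Furthermore, there is a constant $C_2$ depending only on $X$ such that if $f$ is Lipschitz on $Y$ and $F$ is a Lipschitz extension of $f$ to $X$, then $G$ can be chosen, in addition to (i) and (ii), Lipschitz on $X$ with $\operatorname{Lip}(G)\le C_2\operatorname{Lip}(F)$.
   Context: A Banach space $X$ has property $( * )$ if there is a constant $C_0$, depending only on $X$, such that for every Lipschitz function $f:X\to\mathbb{R}$ and every $\varepsilon>0$ there is a Lipschitz, $\mathcal{C}^1$-smooth function $K:X\to\mathbb{R}$ with $|f(x)-K(x)|<\varepsilon$ for all $x\in X$ and $\operatorname{Lip}(K)\le C_0\operatorname{Lip}(f)$. *)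

theory Defs
  imports "HOL-Analysis.Analysis"
begin

definition dual_norm_on :: "'a::real_normed_vector set \<Rightarrow> ('a \<Rightarrow> real) \<Rightarrow> real" where
  "dual_norm_on Y L = (SUP v\<in>{v\<in>Y. norm v \<le> 1}. \<bar>L v\<bar>)"

definition C1_smooth :: "('a::real_normed_vector \<Rightarrow> real) \<Rightarrow> bool" where
  "C1_smooth K \<longleftrightarrow> (\<exists>K'::'a \<Rightarrow> ('a \<Rightarrow>\<^sub>L real).
      (\<forall>x. (K has_derivative blinfun_apply (K' x)) (at x)) \<and> continuous_on UNIV K')"

definition C1_deriv_on :: "'a::real_normed_vector set \<Rightarrow> ('a \<Rightarrow> real) \<Rightarrow> ('a \<Rightarrow> ('a \<Rightarrow>\<^sub>L real)) \<Rightarrow> bool" where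
  "C1_deriv_on Y f f' \<longleftrightarrow>
     (\<forall>y\<in>Y. (f has_derivative blinfun_apply (f' y)) (at y within Y)) \<and>
     (\<forall>y\<in>Y. \<forall>e>0. \<exists>d>0. \<forall>z\<in>Y. dist z y < d \<longrightarrow>
         dual_norm_on Y (\<lambda>v. f' z v - f' y v) < e)"

definition property_star :: "'a::real_normed_vector itself \<Rightarrow> bool" where
  "property_star _ \<longleftrightarrow> (\<exists>C0::real. \<forall>(f::'a \<Rightarrow> real) \<epsilon>. (\<exists>L. L-lipschitz_on UNIV f) \<and> \<epsilon> > 0 \<longrightarrow>
      (\<exists>K. C1_smooth K \<and> (\<exists>L. L-lipschitz_on UNIV K) \<and> (\<forall>x. \<bar>f x - K x\<bar> < \<epsilon>) \<and>
           (\<forall>L. L-lipschitz_on UNIV f \<longrightarrow> (C0 * L)-lipschitz_on UNIV K)))"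

end

theory Submission
  imports Defs
begin

text \<open>
  Near a point \<open>y \<in> Y\<close> the function \<open>f\<close> differs from the functional \<open>f'(y)\<close> by a function with
  small Lipschitz constant. A McShane extension of this difference, smoothed by property \<open>(*)\<close>,
  corrects an extension \<open>\<tau>\<close> of \<open>f'(y)\<close> to \<open>X\<close>, and gives a local \<open>C\<^sup>1\<close> function that is as close to
  \<open>f\<close> on \<open>Y\<close> as one likes, with derivative close to \<open>f'\<close>, on a ball that does not depend on the
  required closeness. If \<open>F\<close> is Lipschitz, \<open>\<tau>\<close> is taken norm-preserving (Hahn--Banach), and a further
  smooth term that is locally constant near \<open>Y\<close> makes the local function close to \<open>F\<close> off \<open>Y\<close> too.

  The local functions are glued by a smooth partition of unity \<open>\<psi>\<^sub>n = \<phi>\<^sub>n \<Prod>\<^sub>j\<^sub><\<^sub>n (1 - \<phi>\<^sub>j)\<close>, where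
  \<open>\<phi>\<^sub>n\<close> is a cut-off around the \<open>n\<close>-th layer of a \<open>\<sigma>\<close>-discrete refinement of the cover by
  balls: each layer consists of sets at distance at least \<open>2\<^sup>-\<^sup>n\<close>, so one bump function made from
  its distance function by property \<open>(*)\<close> serves the whole layer. The closeness in layer \<open>n\<close> is
  chosen after the Lipschitz constant of \<open>\<psi>\<^sub>n\<close>, so the terms \<open>\<psi>\<^sub>n' (K\<^sub>n - F)\<close> of \<open>G'\<close> sum to little.
\<close>

section \<open>Norm-preserving extension of functionals\<close>

text \<open>Homogeneity is an inequality because that is what is checked for an infimum; applying it
  with factor \<open>1/t\<close> recovers equality for \<open>t > 0\<close>.\<close>

definition sublinear :: "('a::real_vector \<Rightarrow> real) \<Rightarrow> bool" where
  "sublinear p \<longleftrightarrow> (\<forall>x y. p (x + y) \<le> p x + p y) \<and> (\<forall>t\<ge>0. \<forall>x. p (t *\<^sub>R x) \<le> t * p x)"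

lemma sublinear_add: "sublinear p \<Longrightarrow> p (x + y) \<le> p x + p y"
  and sublinear_scale_le: "sublinear p \<Longrightarrow> t \<ge> 0 \<Longrightarrow> p (t *\<^sub>R x) \<le> t * p x"
  unfolding sublinear_def by auto

lemma sublinear_zero:
  assumes "sublinear p" shows "p 0 = 0"
  using sublinear_add[OF assms, of 0 0] sublinear_scale_le[OF assms, of 0 0] by simp

lemma sublinear_scale:
  assumes "sublinear p" "t \<ge> 0" shows "p (t *\<^sub>R x) = t * p x"
proof (cases "t = 0")
  case False
  then have "t > 0" using assms by simp
  have "p ((1/t) *\<^sub>R (t *\<^sub>R x)) \<le> (1/t) * p (t *\<^sub>R x)"
    using \<open>t > 0\<close> by (intro sublinear_scale_le[OF assms(1)]) simp
  then have "t * p x \<le> p (t *\<^sub>R x)" using \<open>t > 0\<close> by (simp add: field_simps)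
  then show ?thesis using sublinear_scale_le[OF assms] by (intro antisym)
qed (simp add: sublinear_zero[OF assms(1)])

lemma sublinear_ge_minus:
  assumes "sublinear p" shows "- p (- x) \<le> p x"
  using sublinear_add[OF assms, of x "- x"] sublinear_zero[OF assms] by simp

text \<open>Supplies the bounds of chains for Zorn's lemma. Subadditivity of the infimum uses the
  chain: of \<open>q\<close> chosen at \<open>x\<close> and \<open>r\<close> chosen at
  \<open>y\<close>, the smaller one serves at both points.\<close>

lemma sublinear_INF_chain:
  assumes "C \<noteq> {}" and sub: "\<And>q. q \<in> C \<Longrightarrow> sublinear q"
    and chain: "\<And>q r. q \<in> C \<Longrightarrow> r \<in> C \<Longrightarrow> q \<le> r \<or> r \<le> q"
    and bdd: "\<And>x. bdd_below ((\<lambda>q. q x) ` C)"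
  shows "sublinear (\<lambda>x. INF q\<in>C. q x)" (is "sublinear ?u")
proof -
  have lower: "?u x \<le> q x" if "q \<in> C" for q x
    using cINF_lower[OF bdd that] .
  have "?u (x + y) \<le> q x + r y" if q: "q \<in> C" and r: "r \<in> C" for q r x y
  proof -
    from chain[OF q r] obtain s where s: "s \<in> C" "s x \<le> q x" "s y \<le> r y"
      using q r by (auto simp: le_fun_def)
    show ?thesis using lower[OF s(1), of "x + y"] sublinear_add[OF sub[OF s(1)], of x y] s by linarith
  qed
  note sum_le = this
  have "?u (x + y) - q x \<le> ?u y" if "q \<in> C" for q x y
  proof (rule cINF_greatest[OF assms(1)])
    fix r assume "r \<in> C"
    then show "?u (x + y) - q x \<le> r y" using sum_le[OF that, of r x y] by simp
  qed
  then have add: "?u (x + y) - ?u y \<le> ?u x" for x y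
    by (intro cINF_greatest[OF assms(1)]) (simp add: algebra_simps)
  have scale: "?u (t *\<^sub>R x) \<le> t * ?u x" if "t \<ge> 0" for t x
  proof (cases "t = 0")
    case True
    obtain q where "q \<in> C" using assms(1) by blast
    then have "?u 0 \<le> 0" using lower[of q 0] sublinear_zero[OF sub, of q] by simp
    then show ?thesis using True by simp
  next
    case False
    then have "t > 0" using that by simp
    have "?u (t *\<^sub>R x) / t \<le> ?u x"
    proof (rule cINF_greatest[OF assms(1)])
      fix q assume "q \<in> C"
      then show "?u (t *\<^sub>R x) / t \<le> q x"
        using lower[of q "t *\<^sub>R x"] sublinear_scale[OF sub that, of q x] \<open>t > 0\<close>
        by (simp add: field_simps)
    qed
    then show ?thesis using \<open>t > 0\<close> by (simp add: field_simps)
  qed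
  show ?thesis unfolding sublinear_def using add scale by (auto simp: algebra_simps)
qed

text \<open>Tilting a minimal sublinear functional in a direction \<open>x\<close> produces a smaller one,
  so it is already invariant under all tilts, which is additivity.\<close>

lemma minimal_sublinear_linear:
  assumes m: "sublinear m" and min: "\<And>q. sublinear q \<Longrightarrow> q \<le> m \<Longrightarrow> q = m"
  shows "linear m"
proof -
  have super: "m z + m x \<le> m (z + x)" for z x
  proof -
    define q where "q = (\<lambda>z. INF t\<in>{0..}. m (z + t *\<^sub>R x) - t * m x)"
    \<comment> \<open>Writing \<open>t *\<^sub>R x\<close> as
      \<open>(z + t *\<^sub>R x) + (- z)\<close> and using subadditivity keeps the infimum
      finite.\<close>
    have "- m (- z) \<le> m (z + t *\<^sub>R x) - t * m x" if "t \<ge> 0" for t z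
      using sublinear_add[OF m, of "z + t *\<^sub>R x" "- z"] sublinear_scale[OF m that, of x]
      by simp
    then have bdd: "bdd_below ((\<lambda>t. m (z + t *\<^sub>R x) - t * m x) ` {0..})" for z
      by (intro bdd_belowI2) auto
    have lower: "q z \<le> m (z + t *\<^sub>R x) - t * m x" if "t \<ge> 0" for t z
      unfolding q_def using that by (intro cINF_lower[OF bdd]) auto
    have "q (z + w) \<le> (m (z + s *\<^sub>R x) - s * m x) + (m (w + t *\<^sub>R x) - t * m x)"
      if "s \<ge> 0" "t \<ge> 0" for z w s t
      using lower[of "s + t" "z + w"] that
        sublinear_add[OF m, of "z + s *\<^sub>R x" "w + t *\<^sub>R x"]
      by (simp add: algebra_simps)
    note sum_le = this
    have "q (z + w) - (m (z + s *\<^sub>R x) - s * m x) \<le> q w" if "s \<ge> 0" for z w s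
    proof (subst (2) q_def, rule cINF_greatest)
      fix t :: real assume "t \<in> {0..}"
      then show "q (z + w) - (m (z + s *\<^sub>R x) - s * m x) \<le> m (w + t *\<^sub>R x) - t * m x"
        using sum_le[OF that, of t z w] by simp
    qed simp
    note sum_le = this
    have add: "q (z + w) - q w \<le> q z" for z w
    proof (subst (3) q_def, rule cINF_greatest)
      fix t :: real assume "t \<in> {0..}"
      then show "q (z + w) - q w \<le> m (z + t *\<^sub>R x) - t * m x"
        using sum_le[of t z w] by simp
    qed simp
    have scale: "q (a *\<^sub>R z) \<le> a * q z" if "a \<ge> 0" for a z
    proof (cases "a = 0")
      case True
      then show ?thesis using lower[of 0 0] sublinear_zero[OF m] by simp
    next
      case False
      then have "a > 0" using that by simp
      have "q (a *\<^sub>R z) / a \<le> q z"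
      proof (subst (2) q_def, rule cINF_greatest)
        fix t :: real assume t: "t \<in> {0..}"
        have "q (a *\<^sub>R z) \<le> m (a *\<^sub>R (z + t *\<^sub>R x)) - (a * t) * m x"
          using lower[of "a * t" "a *\<^sub>R z"] t that by (simp add: algebra_simps)
        also have "\<dots> = a * (m (z + t *\<^sub>R x) - t * m x)"
          unfolding sublinear_scale[OF m that] by (simp add: algebra_simps)
        finally show "q (a *\<^sub>R z) / a \<le> m (z + t *\<^sub>R x) - t * m x"
          using \<open>a > 0\<close> by (simp add: field_simps)
      qed simp
      then show ?thesis using \<open>a > 0\<close> by (simp add: field_simps)
    qed
    have "sublinear q" unfolding sublinear_def using add scale by (auto simp: algebra_simps)
    moreover have "q \<le> m" using lower[of 0] by (auto simp: le_fun_def)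
    ultimately have "q = m" by (rule min)
    \<comment> \<open>Since \<open>q = m\<close>, the competitor \<open>t = 1\<close> reads
      \<open>m z \<le> m (z + x) - m x\<close>.\<close>
    then show ?thesis using lower[of 1 z] by simp
  qed
  have add: "m (x + y) = m x + m y" for x y
    using super[of x y] sublinear_add[OF m, of x y] by simp
  have minus: "m (- x) = - m x" for x
    using add[of x "- x"] sublinear_zero[OF m] by simp
  have "m (t *\<^sub>R x) = t * m x" for t x
  proof (cases "t \<ge> 0")
    case False
    then have "m ((- t) *\<^sub>R x) = (- t) * m x" by (intro sublinear_scale[OF m]) simp
    then show ?thesis using minus[of "t *\<^sub>R x"] by simp
  qed (rule sublinear_scale[OF m])
  then show ?thesis using add by (intro linearI) simp_all
qed

text \<open>Zorn's lemma gives a minimal sublinear functional below \<open>p\<close>, and minimal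
  ones are linear.\<close>

lemma linear_below_sublinear:
  assumes p: "sublinear p"
  obtains m where "linear m" "m \<le> p"
proof -
  define A where "A = {q. sublinear q \<and> q \<le> p}"
  \<comment> \<open>The order is reversed, so a maximal element is a minimal functional and a chain
    is bounded by its pointwise infimum.\<close>
  have "\<exists>m\<in>A. \<forall>a\<in>A. a \<le> m \<longrightarrow> a = m"
  proof (rule predicate_Zorn[where P = "\<lambda>a b. b \<le> a"])
    show "partial_order_on A (relation_of (\<lambda>a b. b \<le> a) A)"
      by (rule partial_order_on_relation_ofI) auto
  next
    fix C assume C: "C \<in> Chains (relation_of (\<lambda>a b. b \<le> a) A)"
    show "\<exists>u\<in>A. \<forall>a\<in>C. u \<le> a"
    proof (cases "C = {}")
      case True
      then show ?thesis using p unfolding A_def by auto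
    next
      case False
      have CA: "q \<in> A" if "q \<in> C" for q
        using C that unfolding Chains_def relation_of_def by auto
      have chain: "q \<le> r \<or> r \<le> q" if "q \<in> C" "r \<in> C" for q r
        using C that unfolding Chains_def relation_of_def by blast
      \<comment> \<open>From \<open>q \<le> p\<close> follows
        \<open>- p (- x) \<le> - q (- x) \<le> q x\<close>, so infima over a chain are
        finite.\<close>
      have "- p (- x) \<le> q x" if "q \<in> C" for q x
        using CA[OF that] sublinear_ge_minus[of q x] unfolding A_def le_fun_def
        by (smt (verit) mem_Collect_eq)
      then have bdd: "bdd_below ((\<lambda>q. q x) ` C)" for x
        by (intro bdd_belowI2)
      let ?u = "\<lambda>x. INF q\<in>C. q x"
      have "sublinear ?u"
        using CA chain bdd False by (intro sublinear_INF_chain) (auto simp: A_def)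
      moreover have le: "?u \<le> q" if "q \<in> C" for q
        using cINF_lower[OF bdd that] by (auto simp: le_fun_def)
      moreover have "?u \<le> p"
        using False CA le unfolding A_def by (blast intro: order_trans)
      ultimately show ?thesis unfolding A_def by blast
    qed
  qed
  then obtain m where m: "sublinear m" "m \<le> p" and "\<And>q. sublinear q \<Longrightarrow> q \<le> p \<Longrightarrow> q \<le> m \<Longrightarrow> q = m"
    unfolding A_def by blast
  then have "linear m" by (intro minimal_sublinear_linear) (auto intro: order_trans)
  then show ?thesis using that m by blast
qed

text \<open>Let \<open>m\<close> be linear below the infimal convolution \<open>p\<close> of
  \<open>f\<close> on \<open>Y\<close> with \<open>L * norm\<close>. The competitor 0 bounds
  \<open>m\<close> by \<open>L * norm\<close>; the competitor \<open>x\<close> itself gives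
  \<open>m \<le> f\<close> on \<open>Y\<close>, and passing to negatives turns this into
  equality.\<close>

lemma Hahn_Banach_blinfun:
  fixes f :: "'a::real_normed_vector \<Rightarrow>\<^sub>L real"
  assumes Y: "subspace Y" and "L \<ge> 0" and bound: "\<And>v. v \<in> Y \<Longrightarrow> \<bar>f v\<bar> \<le> L * norm v"
  obtains \<tau> :: "'a \<Rightarrow>\<^sub>L real" where "norm \<tau> \<le> L" "\<And>v. v \<in> Y \<Longrightarrow> \<tau> v = f v"
proof -
  define p where "p x = (INF y\<in>Y. f y + L * norm (x - y))" for x
  have "0 \<in> Y" using Y by (rule subspace_0)
  have "- (L * norm x) \<le> f y + L * norm (x - y)" if "y \<in> Y" for x y
  proof -
    have "norm y \<le> norm x + norm (x - y)"
      using norm_triangle_ineq4[of x "x - y"] by simp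
    then have "L * norm y \<le> L * norm x + L * norm (x - y)"
      using \<open>L \<ge> 0\<close> by (metis distrib_left mult_left_mono)
    then show ?thesis using bound[OF that] by linarith
  qed
  then have bdd: "bdd_below ((\<lambda>y. f y + L * norm (x - y)) ` Y)" for x
    by (intro bdd_belowI2)
  have lower: "p x \<le> f y + L * norm (x - y)" if "y \<in> Y" for x y
    unfolding p_def by (rule cINF_lower[OF bdd that])
  have ne: "Y \<noteq> {}" using \<open>0 \<in> Y\<close> by auto
  have "p (x + z) \<le> (f y + L * norm (x - y)) + (f w + L * norm (z - w))"
    if "y \<in> Y" "w \<in> Y" for x z y w
  proof -
    have "norm (x + z - (y + w)) \<le> norm (x - y) + norm (z - w)"
      by (rule norm_diff_triangle_ineq)
    then have "L * norm (x + z - (y + w)) \<le> L * norm (x - y) + L * norm (z - w)"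
      using \<open>L \<ge> 0\<close> by (metis distrib_left mult_left_mono)
    then show ?thesis
      using lower[OF subspace_add[OF Y that], of "x + z"] by (simp add: blinfun.add_right)
  qed
  note sum_le = this
  have "p (x + z) - (f y + L * norm (x - y)) \<le> p z" if "y \<in> Y" for x z y
  proof (subst (2) p_def, rule cINF_greatest[OF ne])
    fix w assume "w \<in> Y"
    then show "p (x + z) - (f y + L * norm (x - y)) \<le> f w + L * norm (z - w)"
      using sum_le[OF that, of w x z] by simp
  qed
  note sum_le = this
  have add: "p (x + z) - p z \<le> p x" for x z
  proof (subst (3) p_def, rule cINF_greatest[OF ne])
    fix y assume "y \<in> Y"
    then show "p (x + z) - p z \<le> f y + L * norm (x - y)"
      using sum_le[of y x z] by simp
  qed
  have scale: "p (t *\<^sub>R x) \<le> t * p x" if "t \<ge> 0" for t x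
  proof (cases "t = 0")
    case True
    then show ?thesis using lower[OF \<open>0 \<in> Y\<close>, of 0] by simp
  next
    case False
    then have "t > 0" using that by simp
    have "p (t *\<^sub>R x) / t \<le> p x"
    proof (subst (2) p_def, rule cINF_greatest[OF ne])
      fix y assume "y \<in> Y"
      have "norm (t *\<^sub>R x - t *\<^sub>R y) = t * norm (x - y)"
        using \<open>t > 0\<close> by (simp flip: scaleR_diff_right)
      then have "p (t *\<^sub>R x) \<le> t * (f y + L * norm (x - y))"
        using lower[OF subspace_scale[OF Y \<open>y \<in> Y\<close>], of "t *\<^sub>R x" t]
        by (simp add: blinfun.scaleR_right algebra_simps)
      then show "p (t *\<^sub>R x) / t \<le> f y + L * norm (x - y)"
        using \<open>t > 0\<close> by (simp add: field_simps)
    qed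
    then show ?thesis using \<open>t > 0\<close> by (simp add: field_simps)
  qed
  have "sublinear p" unfolding sublinear_def using add scale by (auto simp: algebra_simps)
  then obtain m where m: "linear m" "m \<le> p" by (rule linear_below_sublinear)
  have minus: "m (- x) = - m x" for x using m(1) by (rule linear_neg)
  have "m x \<le> L * norm x" for x
    using m(2) lower[OF \<open>0 \<in> Y\<close>, of x] by (auto simp: le_fun_def intro: order_trans)
  then have bnd: "\<bar>m x\<bar> \<le> L * norm x" for x
    using minus[of x] by (metis abs_le_iff norm_minus_cancel)
  have le: "m y \<le> f y" if "y \<in> Y" for y
    using m(2) lower[OF that, of y] by (auto simp: le_fun_def intro: order_trans)
  have eq: "m y = f y" if "y \<in> Y" for y
    using le[OF that] le[OF subspace_neg[OF Y that]] minus[of y] by (simp add: blinfun.minus_right)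
  have "bounded_linear m"
    using m(1) bnd by (intro bounded_linear_intro[of m L]) (auto simp: linear_add linear_scale mult.commute)
  then have app: "blinfun_apply (Blinfun m) = m" by (rule bounded_linear_Blinfun_apply)
  show ?thesis
  proof (rule that[of "Blinfun m"])
    show "norm (Blinfun m) \<le> L"
      using bnd \<open>L \<ge> 0\<close> by (intro norm_blinfun_bound) (simp_all add: app)
  qed (simp add: app eq)
qed

section \<open>Lipschitz functions\<close>

text \<open>An infimum of the cones \<open>f s + L * dist x s\<close> is again
  \<open>L\<close>-Lipschitz, and at a point of \<open>S\<close> its own cone is the lowest.\<close>

lemma McShane_extension:
  fixes f :: "'a::metric_space \<Rightarrow> real"
  assumes f: "L-lipschitz_on S f"
  obtains g where "L-lipschitz_on UNIV g" "\<And>x. x \<in> S \<Longrightarrow> g x = f x"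
proof (cases "S = {}")
  case True
  have "L-lipschitz_on UNIV (\<lambda>x::'a. 0::real)"
    using lipschitz_on_nonneg[OF f] by (intro lipschitz_onI) auto
  then show ?thesis using that True by blast
next
  case False
  have L: "L \<ge> 0" using lipschitz_on_nonneg[OF f] .
  have tri: "L * dist x z \<le> L * dist x y + L * dist y z" for x y z :: 'a
    using L by (metis distrib_left mult_left_mono dist_triangle)
  have D: "f x \<le> f y + L * dist x y" if "x \<in> S" "y \<in> S" for x y
    using lipschitz_onD[OF f that] by (auto simp: dist_real_def)
  define g where "g x = (INF s\<in>S. f s + L * dist x s)" for x
  obtain a where "a \<in> S" using False by blast
  \<comment> \<open>One fixed point \<open>a\<close> of \<open>S\<close> bounds all cones from
    below.\<close>
  have "f a - L * dist a x \<le> f s + L * dist x s" if "s \<in> S" for s x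
    using D[OF \<open>a \<in> S\<close> that] tri[of a s x] by linarith
  then have bdd: "bdd_below ((\<lambda>s. f s + L * dist x s) ` S)" for x
    by (intro bdd_belowI2)
  have lower: "g x \<le> f s + L * dist x s" if "s \<in> S" for x s
    unfolding g_def by (rule cINF_lower[OF bdd that])
  have half: "g x - L * dist x y \<le> g y" for x y
  proof (subst (2) g_def, rule cINF_greatest[OF False])
    fix s assume "s \<in> S"
    then show "g x - L * dist x y \<le> f s + L * dist y s"
      using lower[of s x] tri[of x s y] by linarith
  qed
  have "L-lipschitz_on UNIV g"
  proof (rule lipschitz_onI[OF _ L])
    fix x y :: 'a
    show "dist (g x) (g y) \<le> L * dist x y"
      using half[of x y] half[of y x] by (simp add: dist_real_def abs_le_iff dist_commute)
  qed
  moreover have "g x = f x" if "x \<in> S" for x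
  proof (rule antisym)
    show "g x \<le> f x" using lower[OF that, of x] by simp
    show "f x \<le> g x" unfolding g_def by (rule cINF_greatest[OF False]) (rule D[OF that])
  qed
  ultimately show ?thesis using that by blast
qed

text \<open>Each Lipschitz inequality is a closed condition on the constant, so the infimum is
  attained. With the least constant, one approximant serves all Lipschitz constants of
  \<open>F\<close> at once.\<close>

lemma lipschitz_on_exact_constant:
  fixes f :: "'a::metric_space \<Rightarrow> 'b::metric_space"
  assumes "L-lipschitz_on S f"
  obtains M where "M-lipschitz_on S f" "\<And>K. K-lipschitz_on S f \<Longrightarrow> M \<le> K"
proof -
  define M where "M = Inf {K. K-lipschitz_on S f}"
  have bdd: "bdd_below {K. K-lipschitz_on S f}"
    by (rule bdd_belowI[of _ 0]) (auto dest: lipschitz_on_nonneg)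
  have ne: "{K. K-lipschitz_on S f} \<noteq> {}" using assms by auto
  have "M-lipschitz_on S f"
  proof (rule lipschitz_onI)
    show "M \<ge> 0" unfolding M_def by (rule cInf_greatest[OF ne]) (auto dest: lipschitz_on_nonneg)
  next
    fix x y assume xy: "x \<in> S" "y \<in> S"
    show "dist (f x) (f y) \<le> M * dist x y"
    proof (cases "x = y")
      case False
      have "dist (f x) (f y) / dist x y \<le> M" unfolding M_def
        using False xy by (intro cInf_greatest[OF ne]) (auto dest: lipschitz_onD simp: divide_le_eq)
      then show ?thesis using False by (simp add: divide_le_eq)
    qed simp
  qed
  moreover have "M \<le> K" if "K-lipschitz_on S f" for K
    unfolding M_def using that by (intro cInf_lower[OF _ bdd]) simp
  ultimately show ?thesis using that by blast
qed

section \<open>Calculus of \<open>C\<^sup>1\<close> functions\<close>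

text \<open>The derivative is an explicit argument, not existentially bound as in
  \<open>C1_smooth\<close>, so that norm bounds and convexity conditions on it can be
  stated.\<close>

definition has_C1_derivative ::
    "('a::real_normed_vector \<Rightarrow> real) \<Rightarrow> ('a \<Rightarrow> 'a \<Rightarrow>\<^sub>L real) \<Rightarrow> bool" where
  "has_C1_derivative K K' \<longleftrightarrow>
     (\<forall>x. (K has_derivative blinfun_apply (K' x)) (at x)) \<and> continuous_on UNIV K'"

lemma has_C1_derivative_D: "has_C1_derivative K K' \<Longrightarrow> (K has_derivative blinfun_apply (K' x)) (at x)"
  and has_C1_derivative_continuous_deriv: "has_C1_derivative K K' \<Longrightarrow> continuous_on UNIV K'"
  unfolding has_C1_derivative_def by auto

lemma has_C1_derivative_continuous: "has_C1_derivative K K' \<Longrightarrow> continuous_on UNIV K"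
  by (meson has_C1_derivative_D has_derivative_continuous continuous_at_imp_continuous_on)

lemma has_C1_derivative_const: "has_C1_derivative (\<lambda>x. c) (\<lambda>x. 0)"
  unfolding has_C1_derivative_def by (auto simp: zero_blinfun.rep_eq)

lemma has_C1_derivative_blinfun: "has_C1_derivative (blinfun_apply \<tau>) (\<lambda>x. \<tau>)"
  unfolding has_C1_derivative_def
  by (auto intro: bounded_linear_imp_has_derivative blinfun.bounded_linear_right)

lemma has_C1_derivative_add:
  assumes "has_C1_derivative f f'" "has_C1_derivative g g'"
  shows "has_C1_derivative (\<lambda>x. f x + g x) (\<lambda>x. f' x + g' x)"
  using assms unfolding has_C1_derivative_def
  by (auto simp: blinfun.add_left[abs_def] intro!: continuous_intros
      intro: has_derivative_eq_rhs[OF has_derivative_add])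

lemma has_C1_derivative_diff:
  assumes "has_C1_derivative f f'" "has_C1_derivative g g'"
  shows "has_C1_derivative (\<lambda>x. f x - g x) (\<lambda>x. f' x - g' x)"
  using assms unfolding has_C1_derivative_def
  by (auto simp: blinfun.diff_left[abs_def] intro!: continuous_intros
      intro: has_derivative_eq_rhs[OF has_derivative_diff])

lemma has_C1_derivative_mult:
  assumes f: "has_C1_derivative f f'" and g: "has_C1_derivative g g'"
  shows "has_C1_derivative (\<lambda>x. f x * g x) (\<lambda>x. f x *\<^sub>R g' x + g x *\<^sub>R f' x)"
  unfolding has_C1_derivative_def
proof (intro conjI allI)
  fix x
  show "((\<lambda>x. f x * g x) has_derivative blinfun_apply (f x *\<^sub>R g' x + g x *\<^sub>R f' x)) (at x)"
    using has_derivative_mult[OF has_C1_derivative_D[OF f] has_C1_derivative_D[OF g], of x]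
    by (rule has_derivative_eq_rhs) (auto simp: blinfun.add_left blinfun.scaleR_left)
qed (intro continuous_intros has_C1_derivative_continuous[OF f] has_C1_derivative_continuous[OF g]
      has_C1_derivative_continuous_deriv[OF f] has_C1_derivative_continuous_deriv[OF g])

lemma has_C1_derivative_compose:
  assumes \<beta>: "\<And>t. (\<beta> has_real_derivative \<beta>' t) (at t)" "continuous_on UNIV \<beta>'"
    and f: "has_C1_derivative f f'"
  shows "has_C1_derivative (\<lambda>x. \<beta> (f x)) (\<lambda>x. \<beta>' (f x) *\<^sub>R f' x)"
  unfolding has_C1_derivative_def
proof (intro conjI allI)
  fix x
  show "((\<lambda>x. \<beta> (f x)) has_derivative blinfun_apply (\<beta>' (f x) *\<^sub>R f' x)) (at x)"
    using has_derivative_compose[OF has_C1_derivative_D[OF f] \<beta>(1)[unfolded has_field_derivative_def], of x]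
    by (rule has_derivative_eq_rhs) (auto simp: blinfun.scaleR_left)
  show "continuous_on UNIV (\<lambda>x. \<beta>' (f x) *\<^sub>R f' x)"
    by (intro continuous_intros has_C1_derivative_continuous_deriv[OF f]
        continuous_on_compose2[OF \<beta>(2) has_C1_derivative_continuous[OF f]]) simp
qed

lemma has_C1_derivative_sum:
  assumes "\<And>i. i \<in> I \<Longrightarrow> has_C1_derivative (f i) (f' i)"
  shows "has_C1_derivative (\<lambda>x. \<Sum>i\<in>I. f i x) (\<lambda>x. \<Sum>i\<in>I. f' i x)"
  using assms unfolding has_C1_derivative_def
  by (auto simp: blinfun.sum_left[abs_def] intro!: continuous_intros
      intro: has_derivative_eq_rhs[OF has_derivative_sum])

lemma has_C1_derivative_local:
  assumes "\<And>x. \<exists>S h h'. open S \<and> x \<in> S \<and> has_C1_derivative h h' \<and> (\<forall>z\<in>S. f z = h z \<and> f' z = h' z)"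
  shows "has_C1_derivative f f'"
  unfolding has_C1_derivative_def
proof (intro conjI allI continuous_at_imp_continuous_on ballI)
  fix x
  obtain S h h' where S: "open S" "x \<in> S" "has_C1_derivative h h'"
    and eq: "\<And>z. z \<in> S \<Longrightarrow> f z = h z" "\<And>z. z \<in> S \<Longrightarrow> f' z = h' z"
    using assms[of x] by blast
  show "(f has_derivative blinfun_apply (f' x)) (at x)"
    using has_derivative_transform_within_open[OF has_C1_derivative_D[OF S(3), of x] S(1,2), of f]
      eq S(2) by simp
  have "isCont h' x"
    using has_C1_derivative_continuous_deriv[OF S(3)] by (simp add: continuous_on_eq_continuous_at)
  moreover have "\<forall>\<^sub>F z in nhds x. f' z = h' z"
    using S eq by (auto simp: eventually_nhds)
  ultimately show "isCont f' x" by (simp add: isCont_cong)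
qed

section \<open>Lipschitz constants as derivative bounds\<close>

text \<open>The line through \<open>x\<close> in direction \<open>v\<close> stays in
  \<open>Y\<close>; its difference quotients are bounded by \<open>L * norm v\<close>, and so is
  their limit.\<close>

lemma lipschitz_derivative_bound:
  fixes f :: "'a::real_normed_vector \<Rightarrow> real"
  assumes L: "L-lipschitz_on Y f" and Y: "subspace Y" and "x \<in> Y" "v \<in> Y"
    and D: "(f has_derivative D) (at x within Y)"
  shows "\<bar>D v\<bar> \<le> L * norm v"
proof -
  have in_Y: "x + t *\<^sub>R v \<in> Y" for t
    using Y \<open>x \<in> Y\<close> \<open>v \<in> Y\<close> by (simp add: subspace_add subspace_scale)
  have "((\<lambda>t. f (x + t *\<^sub>R v)) has_derivative (\<lambda>t. D (t *\<^sub>R v))) (at 0)"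
    by (rule has_derivative_in_compose[of "\<lambda>t. x + t *\<^sub>R v" "\<lambda>t. t *\<^sub>R v" 0 UNIV f])
      (auto intro!: derivative_eq_intros has_derivative_subset[OF D] simp: in_Y)
  then have "((\<lambda>t. f (x + t *\<^sub>R v)) has_real_derivative D v) (at 0)"
    unfolding has_field_derivative_def
    using linear_scale[OF has_derivative_linear[OF D]]
    by (elim has_derivative_eq_rhs) (auto simp: mult.commute)
  then have "((\<lambda>h. (f (x + h *\<^sub>R v) - f x) / h) \<longlongrightarrow> D v) (at 0)"
    by (simp add: DERIV_def)
  then have "((\<lambda>h. \<bar>(f (x + h *\<^sub>R v) - f x) / h\<bar>) \<longlongrightarrow> \<bar>D v\<bar>) (at 0)"
    by (rule tendsto_rabs)
  then show ?thesis
  proof (rule tendsto_upperbound)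
    show "\<forall>\<^sub>F h in at 0. \<bar>(f (x + h *\<^sub>R v) - f x) / h\<bar> \<le> L * norm v"
      using lipschitz_onD[OF L in_Y \<open>x \<in> Y\<close>]
      by (auto simp: eventually_at_filter dist_norm divide_le_eq mult_ac intro!: always_eventually)
  qed simp
qed

lemma C1_lipschitz_iff:
  assumes K: "has_C1_derivative K K'" and "L \<ge> 0"
  shows "L-lipschitz_on UNIV K \<longleftrightarrow> (\<forall>x. norm (K' x) \<le> L)"
proof
  assume "\<forall>x. norm (K' x) \<le> L"
  then show "L-lipschitz_on UNIV K"
    using \<open>L \<ge> 0\<close> has_C1_derivative_D[OF K]
    by (intro bounded_derivative_imp_lipschitz[where f' = "\<lambda>x. blinfun_apply (K' x)"])
      (auto simp: norm_blinfun.rep_eq)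
next
  assume "L-lipschitz_on UNIV K"
  then show "\<forall>x. norm (K' x) \<le> L"
    using lipschitz_derivative_bound[OF _ subspace_UNIV _ _ has_C1_derivative_D[OF K]] \<open>L \<ge> 0\<close>
    by (intro allI norm_blinfun_bound) auto
qed

section \<open>Smoothing with derivative bounds\<close>

text \<open>The smoothing property of the space with the Lipschitz bound on \<open>K\<close> turned
  into a norm bound on \<open>K'\<close>, and with the sign of the constant recorded.\<close>

definition smoothing_constant :: "'a::real_normed_vector itself \<Rightarrow> real \<Rightarrow> bool" where
  "smoothing_constant _ C \<longleftrightarrow> C \<ge> 0 \<and> (\<forall>(f::'a \<Rightarrow> real) L \<epsilon>. L-lipschitz_on UNIV f \<and> \<epsilon> > 0 \<longrightarrow>
     (\<exists>K K'. has_C1_derivative K K' \<and> (\<forall>x. \<bar>f x - K x\<bar> < \<epsilon>) \<and> (\<forall>x. norm (K' x) \<le> C * L)))"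

lemma smoothing_constantE:
  fixes f :: "'a::real_normed_vector \<Rightarrow> real"
  assumes "smoothing_constant TYPE('a) C" "L-lipschitz_on UNIV f" "\<epsilon> > 0"
  obtains K K' where "has_C1_derivative K K'" "\<And>x. \<bar>f x - K x\<bar> < \<epsilon>" "\<And>x. norm (K' x) \<le> C * L"
  using assms unfolding smoothing_constant_def by blast

lemma property_star_smoothing_constant:
  assumes "property_star TYPE('a::real_normed_vector)"
  obtains C where "smoothing_constant TYPE('a) C"
proof -
  obtain C0 :: real where C0: "\<And>(f::'a \<Rightarrow> real) \<epsilon>. (\<exists>L. L-lipschitz_on UNIV f) \<and> \<epsilon> > 0 \<Longrightarrow>
      (\<exists>K. C1_smooth K \<and> (\<exists>L. L-lipschitz_on UNIV K) \<and> (\<forall>x. \<bar>f x - K x\<bar> < \<epsilon>) \<and>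
           (\<forall>L. L-lipschitz_on UNIV f \<longrightarrow> (C0 * L)-lipschitz_on UNIV K))"
    using assms unfolding property_star_def by blast
  \<comment> \<open>Lipschitz constants are nonnegative by definition, so smoothing the zero
    function with \<open>L = 1\<close> forces \<open>C0 \<ge> 0\<close>.\<close>
  have "1-lipschitz_on UNIV (\<lambda>x::'a. 0::real)" by (intro lipschitz_onI) auto
  then have "\<exists>K::'a \<Rightarrow> real. (C0 * 1)-lipschitz_on UNIV K"
    using C0[of "\<lambda>x. 0" 1] by (meson zero_less_one)
  then have "C0 \<ge> 0" using lipschitz_on_nonneg by fastforce
  moreover have "\<exists>K K'. has_C1_derivative K K' \<and> (\<forall>x. \<bar>f x - K x\<bar> < \<epsilon>) \<and> (\<forall>x. norm (K' x) \<le> C0 * L)"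
    if f: "L-lipschitz_on UNIV f" and "\<epsilon> > 0" for f :: "'a \<Rightarrow> real" and L \<epsilon>
  proof -
    obtain K where "C1_smooth K" and K: "\<forall>x. \<bar>f x - K x\<bar> < \<epsilon>" "(C0 * L)-lipschitz_on UNIV K"
      using C0[of f \<epsilon>] f \<open>\<epsilon> > 0\<close> by blast
    then obtain K' where "has_C1_derivative K K'"
      unfolding C1_smooth_def has_C1_derivative_def by blast
    then show ?thesis
      using K C1_lipschitz_iff[of K K' "C0 * L"] lipschitz_on_nonneg[OF K(2)] by blast
  qed
  ultimately have "smoothing_constant TYPE('a) C0" unfolding smoothing_constant_def by blast
  then show ?thesis using that by blast
qed

section \<open>Cut-off functions on the line\<close>

text \<open>The C1 building block of both cut-offs. The delicate point is \<open>t = 0\<close>,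
  where the difference quotient is at most \<open>\<bar>h\<bar>\<close>.\<close>

lemma DERIV_positive_part_squared:
  "((\<lambda>t::real. (max 0 t)\<^sup>2) has_real_derivative 2 * max 0 t) (at t)"
proof -
  consider "t > 0" | "t < 0" | "t = 0" by linarith
  then show ?thesis
  proof cases
    case 1
    have "((\<lambda>t::real. t\<^sup>2) has_real_derivative 2 * max 0 t) (at t)"
      using 1 by (auto intro!: derivative_eq_intros)
    then show ?thesis
      by (rule has_field_derivative_transform_within_open[of _ _ _ "{0<..}"]) (use 1 in auto)
  next
    case 2
    have "((\<lambda>t::real. 0) has_real_derivative 2 * max 0 t) (at t)"
      using 2 by (auto intro!: derivative_eq_intros)
    then show ?thesis
      by (rule has_field_derivative_transform_within_open[of _ _ _ "{..<0}"]) (use 2 in auto)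
  next
    case 3
    have "((\<lambda>h::real. (max 0 h)\<^sup>2 / h) \<longlongrightarrow> 0) (at 0)"
    proof (rule Lim_null_comparison)
      show "\<forall>\<^sub>F h::real in at 0. norm ((max 0 h)\<^sup>2 / h) \<le> \<bar>h\<bar>"
        by (auto simp: eventually_at_filter max_def power2_eq_square intro!: always_eventually)
      show "((\<lambda>h::real. \<bar>h\<bar>) \<longlongrightarrow> 0) (at 0)"
        by (rule tendsto_rabs_zero) simp
    qed
    then show ?thesis using 3 by (simp add: DERIV_def)
  qed
qed

lemma smooth_step:
  obtains \<beta> \<beta>' :: "real \<Rightarrow> real"
  where "\<And>t. (\<beta> has_real_derivative \<beta>' t) (at t)" "continuous_on UNIV \<beta>'"
    "\<And>t. t \<le> 0 \<Longrightarrow> \<beta> t = 1" "\<And>t. t \<ge> 1 \<Longrightarrow> \<beta> t = 0"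
    "\<And>t. 0 \<le> \<beta> t" "\<And>t. \<beta> t \<le> 1" "\<And>t. \<bar>\<beta>' t\<bar> \<le> 2"
proof -
  define p :: "real \<Rightarrow> real" where "p t = (max 0 t)\<^sup>2" for t
  have p: "((\<lambda>t. p (t - a)) has_real_derivative 2 * max 0 (t - a)) (at t)" for a t
    using DERIV_shift[of p "2 * max 0 (t - a)" t "- a"] DERIV_positive_part_squared[of "t - a"]
    by (simp add: p_def[abs_def])
  \<comment> \<open>A second difference of \<open>p\<close> with step \<open>1/2\<close>: the
    derivative is a downward hat of depth 2 on the unit interval.\<close>
  define \<beta> where "\<beta> t = 1 - 2 * (p (t - 0) - 2 * p (t - 1/2) + p (t - 1))" for t
  define \<beta>' :: "real \<Rightarrow> real" where "\<beta>' t = - 4 * (max 0 (t - 0) - 2 * max 0 (t - 1/2) + max 0 (t - 1))" for t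
  have "\<beta> t = (if t \<le> 0 then 1 else if t \<le> 1/2 then 1 - 2 * t\<^sup>2 else if t \<le> 1 then 2 * (1 - t)\<^sup>2 else 0)" for t
    unfolding \<beta>_def p_def by (auto simp: max_def power2_eq_square algebra_simps)
  note \<beta>_eq = this
  show ?thesis
  proof (rule that)
    show "(\<beta> has_real_derivative \<beta>' t) (at t)" for t
      unfolding \<beta>_def[abs_def] \<beta>'_def
      by (rule derivative_eq_intros p refl)+ (simp add: algebra_simps)
    show "continuous_on UNIV \<beta>'" unfolding \<beta>'_def[abs_def] by (intro continuous_intros)
    have sq: "2 * t\<^sup>2 \<le> 1" if "\<bar>t\<bar> \<le> 1/2" for t :: real
      using power_mono[OF that, of 2] by (simp add: power2_eq_square)
    show "0 \<le> \<beta> t" for t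
      using sq[of t] unfolding \<beta>_eq by auto
    show "\<beta> t \<le> 1" for t
      using sq[of "1 - t"] unfolding \<beta>_eq by auto
    show "\<bar>\<beta>' t\<bar> \<le> 2" for t unfolding \<beta>'_def by (auto simp: max_def)
  qed (auto simp: \<beta>_eq)
qed

text \<open>An odd function, flat up to \<open>2 * \<delta>\<close>, whose slope rises from 0 to 1
  until \<open>3 * \<delta>\<close>; from there on it equals \<open>t - 5/2 * \<delta>\<close>. It
  kills the derivative of small values while moving every value only slightly.\<close>

lemma smooth_dead_zone:
  fixes \<delta> :: real
  assumes "\<delta> > 0"
  obtains \<theta> \<theta>' :: "real \<Rightarrow> real"
  where "\<And>t. (\<theta> has_real_derivative \<theta>' t) (at t)" "continuous_on UNIV \<theta>'"
    "\<And>t. \<bar>t\<bar> \<le> 2 * \<delta> \<Longrightarrow> \<theta>' t = 0" "\<And>t. \<bar>\<theta> t - t\<bar> \<le> 3 * \<delta>" "\<And>t. \<bar>\<theta>' t\<bar> \<le> 1"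
proof -
  define p :: "real \<Rightarrow> real" where "p t = (max 0 t)\<^sup>2" for t
  have p: "((\<lambda>t. p (t - a)) has_real_derivative 2 * max 0 (t - a)) (at t)" for a t
    using DERIV_shift[of p "2 * max 0 (t - a)" t "- a"] DERIV_positive_part_squared[of "t - a"]
    by (simp add: p_def[abs_def])
  have p': "((\<lambda>t. p (- t - a)) has_real_derivative - 2 * max 0 (- t - a)) (at t)" for a t
    using DERIV_mirror[of "\<lambda>t. p (t - a)" "2 * max 0 (- t - a)" t] p[of a "- t"] by simp
  define \<theta> where "\<theta> t = 1 / (2 * \<delta>) *
      (p (t - 2 * \<delta>) - p (t - 3 * \<delta>) - (p (- t - 2 * \<delta>) - p (- t - 3 * \<delta>)))" for t
  define \<theta>' where "\<theta>' t = 1 / \<delta> *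
      (max 0 (t - 2 * \<delta>) - max 0 (t - 3 * \<delta>) + (max 0 (- t - 2 * \<delta>) - max 0 (- t - 3 * \<delta>)))" for t
  have bnd: "\<bar>1 / (2 * \<delta>) * (p (t - 2 * \<delta>) - p (t - 3 * \<delta>)) - t\<bar> \<le> 3 * \<delta>" if "t \<ge> 0" for t
  proof -
    consider "t \<le> 2 * \<delta>" | "2 * \<delta> \<le> t" "t \<le> 3 * \<delta>" | "3 * \<delta> \<le> t" by linarith
    then show ?thesis
    proof cases
      case 2
      define u where "u = t - 2 * \<delta>"
      have u: "0 \<le> u" "u \<le> \<delta>" using 2 by (auto simp: u_def)
      have "u * u \<le> \<delta> * (2 * \<delta>)" using u by (intro mult_mono) auto
      then have "0 \<le> u\<^sup>2 / (2 * \<delta>)" "u\<^sup>2 / (2 * \<delta>) \<le> \<delta>"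
        using \<open>\<delta> > 0\<close> u by (auto simp: divide_le_eq power2_eq_square)
      then have "\<bar>u\<^sup>2 / (2 * \<delta>) - t\<bar> \<le> 3 * \<delta>" using 2 unfolding abs_le_iff by linarith
      then show ?thesis using 2 by (simp add: p_def u_def max_def)
    next
      case 3
      have "(t - 2 * \<delta>)\<^sup>2 - (t - 3 * \<delta>)\<^sup>2 = (2 * \<delta>) * (t - 5/2 * \<delta>)"
        by (simp add: power2_eq_square algebra_simps)
      then show ?thesis using 3 \<open>\<delta> > 0\<close> by (simp add: p_def max_def)
    qed (use that \<open>\<delta> > 0\<close> in \<open>simp add: p_def max_def\<close>)
  qed
  show ?thesis
  proof (rule that)
    show "(\<theta> has_real_derivative \<theta>' t) (at t)" for t
      unfolding \<theta>_def[abs_def] \<theta>'_def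
      by (rule derivative_eq_intros p p' refl)+ (use \<open>\<delta> > 0\<close> in \<open>simp add: field_simps\<close>)
    show "continuous_on UNIV \<theta>'" unfolding \<theta>'_def[abs_def] by (intro continuous_intros)
    show "\<theta>' t = 0" if "\<bar>t\<bar> \<le> 2 * \<delta>" for t
      using that \<open>\<delta> > 0\<close> by (auto simp: \<theta>'_def max_def)
    show "\<bar>\<theta> t - t\<bar> \<le> 3 * \<delta>" for t
    proof (cases "t \<ge> 0")
      case True
      then show ?thesis using bnd[of t] \<open>\<delta> > 0\<close> by (simp add: \<theta>_def p_def)
    next
      case False
      then have "\<theta> t - t = - (1 / (2 * \<delta>) * (p (- t - 2 * \<delta>) - p (- t - 3 * \<delta>)) - (- t))"
        using \<open>\<delta> > 0\<close> by (simp add: \<theta>_def p_def field_simps)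
      then show ?thesis using bnd[of "- t"] False by simp
    qed
    have "\<bar>max 0 (t - 2 * \<delta>) - max 0 (t - 3 * \<delta>) + (max 0 (- t - 2 * \<delta>) - max 0 (- t - 3 * \<delta>))\<bar> \<le> \<delta>" for t
      using \<open>\<delta> > 0\<close> by (auto simp: max_def)
    then show "\<bar>\<theta>' t\<bar> \<le> 1" for t
      using \<open>\<delta> > 0\<close> by (simp add: \<theta>'_def abs_mult divide_le_eq)
  qed
qed

section \<open>Gluing local approximations\<close>

text \<open>The first half of A. H. Stone's proof that metric spaces are paracompact.\<close>

lemma separated_decomposition:
  fixes r :: "'a::metric_space \<Rightarrow> real"
  assumes "\<And>x. r x > 0"
  obtains E :: "nat \<Rightarrow> 'a \<Rightarrow> 'a set"
  where "\<And>n x y u v. u \<in> E n x \<Longrightarrow> v \<in> E n y \<Longrightarrow> x \<noteq> y \<Longrightarrow> (1/2)^n \<le> dist u v"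
    "\<And>n x e. e \<in> E n x \<Longrightarrow> ball e ((1/2)^n) \<subseteq> ball x (r x)"
    "\<And>z. \<exists>n x. z \<in> E n x"
proof -
  obtain R :: "'a rel" where R: "Well_order R" "Field R = UNIV" using well_ordering[where 'a = 'a] by auto
  have "well_order_on UNIV R" using R(1) unfolding R(2) .
  then have wf: "wf (R - Id)" and tot: "total_on UNIV R"
    unfolding well_order_on_def linear_order_on_def by blast+
  have tot: "(x, y) \<in> R - Id \<or> (y, x) \<in> R - Id" if "x \<noteq> y" for x y
    using that tot unfolding total_on_def by blast
  \<comment> \<open>Each point goes to the first ball containing it, in the well-order of the
    centres; \<open>n\<close> measures how deep it lies in that ball.\<close>
  define E where "E n x = {z. ball z ((1/2)^n) \<subseteq> ball x (r x) \<and> (\<forall>w. (w, x) \<in> R - Id \<longrightarrow> z \<notin> ball w (r w))}"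
    for n :: nat and x
  show ?thesis
  proof (rule that)
    fix n x y u v assume u: "u \<in> E n x" and v: "v \<in> E n y" and "x \<noteq> y"
    show "(1/2)^n \<le> dist u v"
    proof (rule ccontr)
      assume "\<not> ?thesis"
      \<comment> \<open>Of \<open>x\<close> and \<open>y\<close>, one comes first in
        \<open>R\<close>. Its ball then contains the point assigned to the other centre, which was
        excluded.\<close>
      then have "v \<in> ball u ((1/2)^n)" "u \<in> ball v ((1/2)^n)" by (auto simp: dist_commute)
      then show False using u v tot[OF \<open>x \<noteq> y\<close>] unfolding E_def by blast
    qed
  next
    fix z
    have "z \<in> {x. z \<in> ball x (r x)}" using assms by simp
    from wf[unfolded wf_eq_minimal, rule_format, OF this] obtain x where "x \<in> {x. z \<in> ball x (r x)}"
      and "\<And>w. (w, x) \<in> R - Id \<Longrightarrow> w \<notin> {x. z \<in> ball x (r x)}"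
      by blast
    then have x: "z \<in> ball x (r x)" and min: "\<And>w. (w, x) \<in> R - Id \<Longrightarrow> z \<notin> ball w (r w)"
      by simp_all
    obtain e where e: "e > 0" "ball z e \<subseteq> ball x (r x)"
      using x open_contains_ball[of "ball x (r x)"] by (meson open_ball)
    obtain n :: nat where "(1/2)^n < e" using real_arch_pow_inv[of e "1/2"] e by auto
    then have "ball z ((1/2)^n) \<subseteq> ball x (r x)" using e(2) subset_ball[of "(1/2)^n" e z] by auto
    then show "\<exists>n x. z \<in> E n x" unfolding E_def using min by blast
  qed (simp add: E_def)
qed

section \<open>Bump functions and gluing within one layer\<close>

text \<open>The distance to \<open>E\<close> is smoothed up to an error \<open>s\<close> and
  composed with the smooth step, so one derivative bound \<open>M\<close> holds no matter how many
  pieces \<open>E\<close> has.\<close>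

lemma C1_bump:
  fixes E :: "'a::real_normed_vector set"
  assumes C: "smoothing_constant TYPE('a) C" and "s > 0"
  obtains \<phi> \<phi>' M where "has_C1_derivative \<phi> \<phi>'" "\<And>z. 0 \<le> \<phi> z" "\<And>z. \<phi> z \<le> 1" "\<And>z. norm (\<phi>' z) \<le> M"
    "\<And>z e. e \<in> E \<Longrightarrow> dist z e < s \<Longrightarrow> \<phi> z = 1"
    "\<And>z. \<phi> z \<noteq> 0 \<Longrightarrow> \<exists>e\<in>E. dist z e < 4 * s"
proof (cases "E = {}")
  \<comment> \<open>By convention \<open>infdist\<close> to the empty set is 0, which would give the
    bump 1 everywhere; the zero function is taken instead.\<close>
  case True
  show ?thesis
    by (rule that[of "\<lambda>x. 0" "\<lambda>x. 0" 0]) (use True in \<open>auto simp: has_C1_derivative_const\<close>)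
next
  case False
  have "1-lipschitz_on UNIV (\<lambda>x. infdist x E)"
    by (intro lipschitz_onI) (auto simp: dist_real_def infdist_triangle_abs)
  then obtain k k' where k: "has_C1_derivative k k'" "\<And>x. \<bar>infdist x E - k x\<bar> < s" "\<And>x. norm (k' x) \<le> C * 1"
    using smoothing_constantE[OF C _ \<open>s > 0\<close>] by blast
  obtain \<beta> \<beta>' where \<beta>: "\<And>t. (\<beta> has_real_derivative \<beta>' t) (at t)" "continuous_on UNIV \<beta>'"
    "\<And>t. t \<le> 0 \<Longrightarrow> \<beta> t = 1" "\<And>t. t \<ge> 1 \<Longrightarrow> \<beta> t = 0"
    "\<And>t. 0 \<le> \<beta> t" "\<And>t. \<beta> t \<le> 1" "\<And>t. \<bar>\<beta>' t\<bar> \<le> 2"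
    using smooth_step by blast
  \<comment> \<open>With the shift by 2, distance below \<open>s\<close> gives
    \<open>k x < 2 * s\<close> and a negative argument, hence value 1; a nonzero value gives
    \<open>k x < 3 * s\<close>, hence distance below \<open>4 * s\<close>.\<close>
  define h where "h x = (1/s) * k x + (-2)" for x
  have h: "has_C1_derivative h (\<lambda>x. ((1/s) *\<^sub>R k' x + k x *\<^sub>R 0) + 0)"
    unfolding h_def[abs_def]
    by (intro has_C1_derivative_add has_C1_derivative_mult has_C1_derivative_const k(1))
  show ?thesis
  proof (rule that[of "\<lambda>x. \<beta> (h x)" "\<lambda>x. \<beta>' (h x) *\<^sub>R (((1/s) *\<^sub>R k' x + k x *\<^sub>R 0) + 0)" "2 * ((1/s) * C)"])
    show "has_C1_derivative (\<lambda>x. \<beta> (h x)) (\<lambda>x. \<beta>' (h x) *\<^sub>R (((1/s) *\<^sub>R k' x + k x *\<^sub>R 0) + 0))"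
      by (rule has_C1_derivative_compose[OF \<beta>(1,2) h])
    fix z
    have "\<bar>\<beta>' (h z)\<bar> * (norm (k' z) / s) \<le> 2 * (C / s)"
      using \<beta>(7)[of "h z"] k(3)[of z] \<open>s > 0\<close> by (intro mult_mono divide_right_mono) auto
    then show "norm (\<beta>' (h z) *\<^sub>R (((1/s) *\<^sub>R k' z + k z *\<^sub>R 0) + 0)) \<le> 2 * ((1/s) * C)"
      using \<open>s > 0\<close> by simp
    show "\<exists>e\<in>E. dist z e < 4 * s" if "\<beta> (h z) \<noteq> 0"
    proof -
      have "h z < 1" by (rule ccontr) (use \<beta>(4)[of "h z"] that in simp)
      then have "k z < 3 * s" using \<open>s > 0\<close> by (simp add: h_def field_simps)
      then have "infdist z E < 4 * s" using k(2)[of z] by linarith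
      then have "(INF e\<in>E. dist z e) < 4 * s" using False by (simp add: infdist_notempty)
      then show ?thesis using False by (subst (asm) cINF_less_iff) (auto intro: bdd_belowI2[of _ 0])
    qed
    fix e assume "e \<in> E" "dist z e < s"
    then have "infdist z E < s" using infdist_le[of e E z] by simp
    then have "k z < 2 * s" using k(2)[of z] by linarith
    then show "\<beta> (h z) = 1" using \<open>s > 0\<close> by (intro \<beta>(3)) (simp add: h_def field_simps)
  qed (use \<beta> in auto)
qed

text \<open>Applied at zeros of nonnegative functions: there the derivative vanishes too, so whole
  terms of the product rule drop out.\<close>

lemma C1_derivative_zero_at_extremum:
  assumes "has_C1_derivative f f'" "(\<forall>y. f y \<le> f x) \<or> (\<forall>y. f x \<le> f y)"
  shows "f' x = 0"
  using differential_zero_maxmin[OF _ open_UNIV has_C1_derivative_D[OF assms(1), of x]] assms(2)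
  by (intro blinfun_eqI) (auto simp: zero_blinfun.rep_eq fun_eq_iff)

text \<open>The pieces are so far apart that on a ball of radius \<open>s\<close> at most one
  \<open>K x\<close> is active, and the glued function is locally a plain product.\<close>

lemma C1_glue_separated:
  fixes E :: "'i \<Rightarrow> 'a::real_normed_vector set"
  assumes "s > 0" and sep: "\<And>x y u v. u \<in> E x \<Longrightarrow> v \<in> E y \<Longrightarrow> x \<noteq> y \<Longrightarrow> 16 * s \<le> dist u v"
    and \<phi>: "has_C1_derivative \<phi> \<phi>'" "\<And>z. 0 \<le> \<phi> z"
    and supp: "\<And>z. \<phi> z \<noteq> 0 \<Longrightarrow> \<exists>e\<in>\<Union>(range E). dist z e < 4 * s"
    and K: "\<And>x. has_C1_derivative (K x) (K' x)"
  obtains g g' where "has_C1_derivative g g'"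
    "\<And>z. \<phi> z = 0 \<Longrightarrow> g z = 0 \<and> g' z = 0 \<and> \<phi>' z = 0"
    "\<And>z. \<phi> z \<noteq> 0 \<Longrightarrow> \<exists>x. (\<exists>e\<in>E x. dist z e < 4 * s) \<and>
        g z = \<phi> z * K x z \<and> g' z = \<phi> z *\<^sub>R K' x z + K x z *\<^sub>R \<phi>' z"
proof -
  have \<phi>'0: "\<phi>' z = 0" if "\<phi> z = 0" for z
    using C1_derivative_zero_at_extremum[OF \<phi>(1)] that \<phi>(2) by auto
  \<comment> \<open>Where \<open>\<phi>\<close> vanishes the chosen index is arbitrary, but it is
    then multiplied by zero.\<close>
  define \<rho> where "\<rho> z = (SOME x. \<exists>e\<in>E x. dist z e < 4 * s)" for z
  have \<rho>: "\<exists>e\<in>E (\<rho> z). dist z e < 4 * s" if "\<phi> z \<noteq> 0" for z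
    unfolding \<rho>_def by (rule someI_ex) (use supp[OF that] in blast)
  define g where "g z = \<phi> z * K (\<rho> z) z" for z
  define g' where "g' z = \<phi> z *\<^sub>R K' (\<rho> z) z + K (\<rho> z) z *\<^sub>R \<phi>' z" for z
  have "has_C1_derivative g g'"
  proof (rule has_C1_derivative_local)
    fix z
    have same: "\<rho> w = \<rho> w'" if w: "w \<in> ball z s" "w' \<in> ball z s" "\<phi> w \<noteq> 0" "\<phi> w' \<noteq> 0" for w w'
    proof (rule ccontr)
      assume ne: "\<rho> w \<noteq> \<rho> w'"
      obtain e where e: "e \<in> E (\<rho> w)" "dist w e < 4 * s" using \<rho>[OF w(3)] by blast
      obtain e' where e': "e' \<in> E (\<rho> w')" "dist w' e' < 4 * s" using \<rho>[OF w(4)] by blast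
      \<comment> \<open>The four summands are below \<open>4 * s\<close>, \<open>s\<close>,
        \<open>s\<close> and \<open>4 * s\<close>; their total \<open>10 * s\<close> contradicts the
        separation \<open>16 * s\<close>.\<close>
      have "dist e e' \<le> dist w e + dist z w + dist z w' + dist w' e'"
        by (smt (verit) dist_commute dist_triangle)
      then show False using e e' w(1,2) \<open>s > 0\<close> sep[OF e(1) e'(1) ne] by simp
    qed
    obtain x where x: "\<And>w. w \<in> ball z s \<Longrightarrow> \<phi> w \<noteq> 0 \<Longrightarrow> \<rho> w = x"
    proof (cases "\<exists>w\<in>ball z s. \<phi> w \<noteq> 0")
      case True
      then show ?thesis using that same by blast
    qed (use that in blast)
    show "\<exists>S h h'. open S \<and> z \<in> S \<and> has_C1_derivative h h' \<and> (\<forall>z\<in>S. g z = h z \<and> g' z = h' z)"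
    proof (intro exI conjI ballI)
      show "has_C1_derivative (\<lambda>w. \<phi> w * K x w) (\<lambda>w. \<phi> w *\<^sub>R K' x w + K x w *\<^sub>R \<phi>' w)"
        by (rule has_C1_derivative_mult[OF \<phi>(1) K])
      fix w assume "w \<in> ball z s"
      then show "g w = \<phi> w * K x w" "g' w = \<phi> w *\<^sub>R K' x w + K x w *\<^sub>R \<phi>' w"
        using x \<phi>'0 unfolding g_def g'_def by (cases "\<phi> w = 0"; simp)+
    qed (use \<open>s > 0\<close> in auto)
  qed
  then show ?thesis
  proof (rule that)
    fix z
    show "g z = 0 \<and> g' z = 0 \<and> \<phi>' z = 0" if "\<phi> z = 0"
      using \<phi>'0[OF that] that by (simp add: g_def g'_def)
    show "\<exists>x. (\<exists>e\<in>E x. dist z e < 4 * s) \<and>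
        g z = \<phi> z * K x z \<and> g' z = \<phi> z *\<^sub>R K' x z + K x z *\<^sub>R \<phi>' z" if "\<phi> z \<noteq> 0"
      using \<rho>[OF that] by (intro exI[of _ "\<rho> z"]) (simp add: g_def g'_def)
  qed
qed

section \<open>A partition of unity from products\<close>

text \<open>The product of \<open>1 - \<phi> j\<close> over \<open>j < n\<close>: the mass not yet
  distributed by the first \<open>n\<close> layers.\<close>

primrec remainder :: "(nat \<Rightarrow> 'a \<Rightarrow> real) \<Rightarrow> nat \<Rightarrow> 'a \<Rightarrow> real" where
  "remainder \<phi> 0 z = 1"
| "remainder \<phi> (Suc n) z = remainder \<phi> n z * (1 - \<phi> n z)"

primrec remainder_deriv ::
    "(nat \<Rightarrow> 'a::real_normed_vector \<Rightarrow> real) \<Rightarrow> (nat \<Rightarrow> 'a \<Rightarrow> 'a \<Rightarrow>\<^sub>L real) \<Rightarrow> nat \<Rightarrow> 'a \<Rightarrow> 'a \<Rightarrow>\<^sub>L real" where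
  "remainder_deriv \<phi> \<phi>' 0 z = 0"
| "remainder_deriv \<phi> \<phi>' (Suc n) z =
     remainder \<phi> n z *\<^sub>R (0 - \<phi>' n z) + (1 - \<phi> n z) *\<^sub>R remainder_deriv \<phi> \<phi>' n z"

lemma has_C1_derivative_remainder:
  assumes "\<And>n. has_C1_derivative (\<phi> n) (\<phi>' n)"
  shows "has_C1_derivative (remainder \<phi> n) (remainder_deriv \<phi> \<phi>' n)"
proof (induction n)
  case 0
  then show ?case using has_C1_derivative_const[of 1] by (simp add: has_C1_derivative_def)
next
  case (Suc n)
  have "has_C1_derivative (\<lambda>z. remainder \<phi> n z * (1 - \<phi> n z))
     (\<lambda>z. remainder \<phi> n z *\<^sub>R (0 - \<phi>' n z) + (1 - \<phi> n z) *\<^sub>R remainder_deriv \<phi> \<phi>' n z)"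
    by (intro has_C1_derivative_mult has_C1_derivative_diff has_C1_derivative_const assms Suc)
  then show ?case by (simp add: has_C1_derivative_def)
qed

lemma remainder_range:
  assumes "\<And>n. 0 \<le> \<phi> n z" "\<And>n. \<phi> n z \<le> 1"
  shows "0 \<le> remainder \<phi> n z" "remainder \<phi> n z \<le> 1"
proof (induction n)
  case (Suc n)
  case 1 show ?case using Suc assms by simp
  case 2 show ?case using Suc assms mult_le_one[of "remainder \<phi> n z" "1 - \<phi> n z"] by simp
qed simp_all

text \<open>All factors lie between 0 and 1, so each product rule step adds at most one
  \<open>M n\<close>.\<close>

lemma norm_remainder_deriv_le:
  assumes "\<And>n. 0 \<le> \<phi> n z" "\<And>n. \<phi> n z \<le> 1" "\<And>n. norm (\<phi>' n z) \<le> M n"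
  shows "norm (remainder_deriv \<phi> \<phi>' n z) \<le> (\<Sum>j<n. M j)"
proof (induction n)
  case (Suc n)
  have "norm (remainder_deriv \<phi> \<phi>' (Suc n) z) \<le>
      \<bar>remainder \<phi> n z\<bar> * norm (\<phi>' n z) + \<bar>1 - \<phi> n z\<bar> * norm (remainder_deriv \<phi> \<phi>' n z)"
    using norm_triangle_ineq4[of "(1 - \<phi> n z) *\<^sub>R remainder_deriv \<phi> \<phi>' n z" "remainder \<phi> n z *\<^sub>R \<phi>' n z"]
    by simp
  also have "\<dots> \<le> 1 * M n + 1 * (\<Sum>j<n. M j)"
    using remainder_range[of \<phi> z n, OF assms(1,2)] assms Suc by (intro add_mono mult_mono) auto
  finally show ?case by simp
qed simp

text \<open>Both sums telescope, since \<open>remainder \<phi> j z * \<phi> j z\<close> is the drop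
  from stage \<open>j\<close> to the next; the second line is the derivative of the first.\<close>

lemma sum_remainder:
  "(\<Sum>j<n. remainder \<phi> j z * \<phi> j z) = 1 - remainder \<phi> n z"
  "(\<Sum>j<n. remainder \<phi> j z *\<^sub>R \<phi>' j z + \<phi> j z *\<^sub>R remainder_deriv \<phi> \<phi>' j z) = - remainder_deriv \<phi> \<phi>' n z"
  by (induction n) (simp_all add: algebra_simps)

lemma remainder_vanishes:
  assumes "\<phi> j z = 1" "j < n" shows "remainder \<phi> n z = 0"
  using assms(2) by (induction n) (auto simp: less_Suc_eq assms(1))

lemma sum_half_powers_le: "(\<Sum>j<n. (1/2 :: real) ^ Suc j) \<le> 1"
proof -
  have "(\<Sum>j<n. (1/2 :: real) ^ Suc j) = 1 - (1/2)^n" by (induction n) simp_all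
  then show ?thesis by simp
qed

text \<open>The radius precedes \<open>\<delta>\<close> in the hypothesis, so layers, bumps and
  their derivative bounds are fixed before the accuracy on \<open>A\<close> is chosen. Convexity of
  \<open>Q z\<close> lets weighted averages of the \<open>K'\<close> remain admissible.\<close>

lemma C1_glue:
  fixes F :: "'a::real_normed_vector \<Rightarrow> real" and Q :: "'a \<Rightarrow> ('a \<Rightarrow>\<^sub>L real) set"
  assumes C: "smoothing_constant TYPE('a) C" and "\<eta> > 0"
    and cvx: "\<And>z. z \<in> A \<Longrightarrow> convex (Q z)"
    and "\<And>x. \<exists>r>0. \<forall>\<delta>>0. \<exists>K K'. has_C1_derivative K K' \<and>
      (\<forall>z\<in>ball x r. \<bar>K z - F z\<bar> \<le> \<epsilon> \<and> (z \<in> A \<longrightarrow> \<bar>K z - F z\<bar> \<le> \<delta> \<and> K' z \<in> Q z))"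
  obtains G G' where "has_C1_derivative G G'" "\<And>z. \<bar>G z - F z\<bar> \<le> \<epsilon>"
    "\<And>z. z \<in> A \<Longrightarrow> \<exists>q\<in>Q z. norm (G' z - q) \<le> \<eta>"
proof -
  obtain r where r: "\<And>x. r x > 0" and local: "\<And>x \<delta>. \<delta> > 0 \<Longrightarrow> \<exists>K K'. has_C1_derivative K K' \<and>
      (\<forall>z\<in>ball x (r x). \<bar>K z - F z\<bar> \<le> \<epsilon> \<and> (z \<in> A \<longrightarrow> \<bar>K z - F z\<bar> \<le> \<delta> \<and> K' z \<in> Q z))"
    using assms(4) by metis
  obtain E :: "nat \<Rightarrow> 'a \<Rightarrow> 'a set"
    where sep: "\<And>n x y u v. u \<in> E n x \<Longrightarrow> v \<in> E n y \<Longrightarrow> x \<noteq> y \<Longrightarrow> (1/2)^n \<le> dist u v"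
    and inball: "\<And>n x e. e \<in> E n x \<Longrightarrow> ball e ((1/2)^n) \<subseteq> ball x (r x)"
    and cover: "\<And>z. \<exists>n x. z \<in> E n x"
    using separated_decomposition[of r] r by blast
  \<comment> \<open>The factor 16 matches the separation demanded by
    \<open>C1_glue_separated\<close>, and \<open>4 * s n\<close> stays below
    \<open>(1/2)^n\<close>.\<close>
  define s :: "nat \<Rightarrow> real" where "s n = (1/2)^n / 16" for n
  have s: "s n > 0" for n by (simp add: s_def)
  have "\<exists>\<phi> \<phi>' M. has_C1_derivative \<phi> \<phi>' \<and> (\<forall>z. 0 \<le> \<phi> z) \<and> (\<forall>z. \<phi> z \<le> 1) \<and> (\<forall>z. norm (\<phi>' z) \<le> M) \<and>
    (\<forall>z. \<forall>e\<in>\<Union>(range (E n)). dist z e < s n \<longrightarrow> \<phi> z = 1) \<and>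
    (\<forall>z. \<phi> z \<noteq> 0 \<longrightarrow> (\<exists>e\<in>\<Union>(range (E n)). dist z e < 4 * s n))" for n
    using C1_bump[OF C s[of n], of "\<Union>(range (E n))"] by metis
  then obtain \<phi> \<phi>' M where \<phi>: "\<And>n. has_C1_derivative (\<phi> n) (\<phi>' n)"
    "\<And>n z. 0 \<le> \<phi> n z" "\<And>n z. \<phi> n z \<le> 1" "\<And>n z. norm (\<phi>' n z) \<le> M n"
    and one: "\<And>n x z e. e \<in> E n x \<Longrightarrow> dist z e < s n \<Longrightarrow> \<phi> n z = 1"
    and supp: "\<And>n z. \<phi> n z \<noteq> 0 \<Longrightarrow> \<exists>e\<in>\<Union>(range (E n)). dist z e < 4 * s n"
    by (metis UNIV_I UN_I)
  have M: "M n \<ge> 0" for n using \<phi>(4)[of n undefined] norm_ge_zero order_trans by blast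
  define B where "B n = (\<Sum>j<n. M j)" for n
  have B: "B n \<ge> 0" for n unfolding B_def by (intro sum_nonneg M)
  \<comment> \<open>\<open>B (Suc n)\<close> will bound the derivative of the \<open>n\<close>-th
    weight. The powers of \<open>1/2\<close> make the errors sum to at most \<open>\<eta>\<close>;
    the added 1 keeps the denominator positive.\<close>
  define \<delta> where "\<delta> n = \<eta> * (1/2) ^ Suc n / (B (Suc n) + 1)" for n
  have \<delta>: "\<delta> n > 0" for n using \<open>\<eta> > 0\<close> B[of "Suc n"] by (simp add: \<delta>_def)
  have \<delta>B: "\<delta> n * B (Suc n) \<le> \<eta> * (1/2) ^ Suc n" for n
  proof -
    have "\<delta> n * B (Suc n) \<le> \<delta> n * (B (Suc n) + 1)" using \<delta>[of n] by simp
    also have "\<delta> n * (B (Suc n) + 1) = \<eta> * (1/2) ^ Suc n"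
      using B[of "Suc n"] by (intro iffD1[OF nonzero_eq_divide_eq \<delta>_def]) simp
    finally show ?thesis .
  qed
  have "\<exists>K K'. \<forall>x. has_C1_derivative (K x) (K' x) \<and>
      (\<forall>z\<in>ball x (r x). \<bar>K x z - F z\<bar> \<le> \<epsilon> \<and> (z \<in> A \<longrightarrow> \<bar>K x z - F z\<bar> \<le> \<delta> n \<and> K' x z \<in> Q z))" for n
    using local[OF \<delta>[of n]] by metis
  then obtain K K' where K: "\<And>n x. has_C1_derivative (K n x) (K' n x)"
    and K\<epsilon>: "\<And>n x z. z \<in> ball x (r x) \<Longrightarrow> \<bar>K n x z - F z\<bar> \<le> \<epsilon>"
    and KA: "\<And>n x z. z \<in> ball x (r x) \<Longrightarrow> z \<in> A \<Longrightarrow> \<bar>K n x z - F z\<bar> \<le> \<delta> n \<and> K' n x z \<in> Q z"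
    by metis
  have "\<exists>g g'. has_C1_derivative g g' \<and> (\<forall>z. \<exists>x. z \<in> ball x (r x) \<and>
      g z = \<phi> n z * K n x z \<and> g' z = \<phi> n z *\<^sub>R K' n x z + K n x z *\<^sub>R \<phi>' n z)" for n
  proof -
    obtain g g' where g: "has_C1_derivative g g'"
      and g0: "\<And>z. \<phi> n z = 0 \<Longrightarrow> g z = 0 \<and> g' z = 0 \<and> \<phi>' n z = 0"
      and g1: "\<And>z. \<phi> n z \<noteq> 0 \<Longrightarrow> \<exists>x. (\<exists>e\<in>E n x. dist z e < 4 * s n) \<and>
        g z = \<phi> n z * K n x z \<and> g' z = \<phi> n z *\<^sub>R K' n x z + K n x z *\<^sub>R \<phi>' n z"
    proof (rule C1_glue_separated[where s = "s n" and E = "E n" and \<phi> = "\<phi> n" and \<phi>' = "\<phi>' n"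
          and K = "K n" and K' = "K' n"])
      show "16 * s n \<le> dist u v" if "u \<in> E n x" "v \<in> E n y" "x \<noteq> y" for x y u v
        using sep[OF that] by (simp add: s_def)
    qed (rule s \<phi> K | erule supp | blast)+
    have "\<exists>x. z \<in> ball x (r x) \<and>
      g z = \<phi> n z * K n x z \<and> g' z = \<phi> n z *\<^sub>R K' n x z + K n x z *\<^sub>R \<phi>' n z" for z
    proof (cases "\<phi> n z = 0")
      case True
      \<comment> \<open>All terms vanish here, so any index whose ball contains \<open>z\<close>
        will do, for instance \<open>z\<close> itself.\<close>
      then show ?thesis using g0[OF True] r[of z] by (intro exI[of _ z]) simp
    next
      case False
      then obtain x e where e: "e \<in> E n x" "dist z e < 4 * s n"
        "g z = \<phi> n z * K n x z" "g' z = \<phi> n z *\<^sub>R K' n x z + K n x z *\<^sub>R \<phi>' n z"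
        using g1 by blast
      have "4 * s n < (1/2)^n" by (simp add: s_def)
      then have "z \<in> ball e ((1/2)^n)" using e(2) by (simp only: mem_ball dist_commute[of e])
      then show ?thesis using e inball by blast
    qed
    then show ?thesis using g by blast
  qed
  then obtain g g' x where g: "\<And>n. has_C1_derivative (g n) (g' n)"
    and x: "\<And>n z. z \<in> ball (x n z) (r (x n z))"
    and g_eq: "\<And>n z. g n z = \<phi> n z * K n (x n z) z"
    and g'_eq: "\<And>n z. g' n z = \<phi> n z *\<^sub>R K' n (x n z) z + K n (x n z) z *\<^sub>R \<phi>' n z"
    by metis
  define c where "c = remainder \<phi>"
  define c' where "c' = remainder_deriv \<phi> \<phi>'"
  have c: "has_C1_derivative (c n) (c' n)" for n
    unfolding c_def c'_def by (rule has_C1_derivative_remainder[OF \<phi>(1)])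
  have c01: "0 \<le> c n z" "c n z \<le> 1" for n z
    unfolding c_def using remainder_range[of \<phi> z n] \<phi> by auto
  have c'B: "norm (c' n z) \<le> B n" for n z
    unfolding c'_def B_def using norm_remainder_deriv_le[of \<phi> z \<phi>' M n] \<phi> by auto
  define S where "S n z = (\<Sum>j<n. c j z * g j z)" for n z
  define S' where "S' n z = (\<Sum>j<n. c j z *\<^sub>R g' j z + g j z *\<^sub>R c' j z)" for n z
  have S: "has_C1_derivative (S n) (S' n)" for n
    unfolding S_def[abs_def] S'_def[abs_def]
    by (intro has_C1_derivative_sum has_C1_derivative_mult c g)
  \<comment> \<open>Near a point of layer \<open>n\<close> the bump of that layer is 1, so later
    weights vanish there: the partition is locally finite.\<close>
  have nbhd: "\<exists>n U. open U \<and> z \<in> U \<and> (\<forall>w\<in>U. c n w = 0)" for z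
  proof -
    obtain n y where "z \<in> E n y" using cover by blast
    then have "\<forall>w\<in>ball z (s n). c (Suc n) w = 0"
      using one[of z n y] remainder_vanishes[of \<phi> n _ "Suc n"] by (auto simp: c_def dist_commute)
    then show ?thesis using s[of n] by (metis centre_in_ball open_ball)
  qed
  have c_mono: "c m z = 0" if "c n z = 0" "n \<le> m" for n m z
    using that(2,1) unfolding c_def by (induction m rule: dec_induct) auto
  have c'0: "c' n z = 0" if "c n z = 0" for n z
    using C1_derivative_zero_at_extremum[OF c] that c01(1) by auto
  have stable: "S m z = S n z \<and> S' m z = S' n z" if "c n z = 0" "n \<le> m" for n m z
    using that(2)
  proof (induction m rule: dec_induct)
    case (step m)
    then have "c m z = 0" "c' m z = 0" using c_mono[OF that(1)] c'0 by auto
    then show ?case using step by (simp add: S_def S'_def)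
  qed simp
  \<comment> \<open>The number of layers that matter at \<open>z\<close>; the full series is the
    stabilised partial sum at this index.\<close>
  define N where "N z = (LEAST n. c n z = 0)" for z
  have N0: "c (N z) z = 0" for z
    unfolding N_def by (rule LeastI_ex) (use nbhd in blast)
  have N_le: "N z \<le> n" if "c n z = 0" for n z
    unfolding N_def by (rule Least_le) (rule that)
  define w where "w j z = c j z * \<phi> j z" for j z
  define w' where "w' j z = c j z *\<^sub>R \<phi>' j z + \<phi> j z *\<^sub>R c' j z" for j z
  have w0: "w j z \<ge> 0" for j z unfolding w_def using c01 \<phi> by simp
  have w1: "(\<Sum>j<N z. w j z) = 1" for z
    using sum_remainder(1)[of \<phi> z "N z"] N0[of z] by (simp add: w_def c_def)
  have w'0: "(\<Sum>j<N z. w' j z) = 0" for z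
    using sum_remainder(2)[of \<phi> z \<phi>' "N z"] c'0[OF N0[of z]] by (simp add: w'_def c_def c'_def)
  have w'B: "norm (w' j z) \<le> B (Suc j)" for j z
  proof -
    have "norm (w' j z) \<le> \<bar>c j z\<bar> * norm (\<phi>' j z) + \<bar>\<phi> j z\<bar> * norm (c' j z)"
      unfolding w'_def by (rule norm_triangle_le) simp
    also have "\<dots> \<le> 1 * M j + 1 * B j"
      using c01[of j z] \<phi>(2,3,4)[of j z] c'B[of j z] by (intro add_mono mult_mono) auto
    finally show ?thesis by (simp add: B_def)
  qed
  have S_eq: "S (N z) z = (\<Sum>j<N z. w j z * K j (x j z) z)" for z
    unfolding S_def w_def g_eq by (simp add: mult_ac)
  have S'_eq: "S' (N z) z = (\<Sum>j<N z. w j z *\<^sub>R K' j (x j z) z) + (\<Sum>j<N z. K j (x j z) z *\<^sub>R w' j z)" for z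
    unfolding S'_def w_def w'_def g_eq g'_eq by (simp add: algebra_simps sum.distrib)
  show ?thesis
  proof (rule that[of "\<lambda>z. S (N z) z" "\<lambda>z. S' (N z) z"])
    show "has_C1_derivative (\<lambda>z. S (N z) z) (\<lambda>z. S' (N z) z)"
    proof (rule has_C1_derivative_local)
      fix z
      obtain n U where U: "open U" "z \<in> U" "\<And>w. w \<in> U \<Longrightarrow> c n w = 0" using nbhd[of z] by blast
      \<comment> \<open>On \<open>U\<close> the index \<open>N w\<close> varies but is at most
        \<open>n\<close>, so the fixed partial sum \<open>S n\<close> represents the series.\<close>
      have "\<forall>w\<in>U. S (N w) w = S n w \<and> S' (N w) w = S' n w"
        using stable[OF N0 N_le] U(3) by metis
      then show "\<exists>U h h'. open U \<and> z \<in> U \<and> has_C1_derivative h h' \<and>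
          (\<forall>z\<in>U. S (N z) z = h z \<and> S' (N z) z = h' z)"
        using U S by blast
    qed
    fix z
    have "S (N z) z - F z = (\<Sum>j<N z. w j z * (K j (x j z) z - F z))"
      using w1[of z] by (simp add: S_eq right_diff_distrib sum_subtractf flip: sum_distrib_right)
    also have "\<bar>\<dots>\<bar> \<le> (\<Sum>j<N z. w j z * \<epsilon>)"
      using w0 K\<epsilon>[OF x] by (intro order_trans[OF sum_abs] sum_mono) (auto simp: abs_mult intro!: mult_left_mono)
    also have "\<dots> = \<epsilon>" using w1[of z] by (simp flip: sum_distrib_right)
    finally show "\<bar>S (N z) z - F z\<bar> \<le> \<epsilon>" .
    assume "z \<in> A"
    show "\<exists>q\<in>Q z. norm (S' (N z) z - q) \<le> \<eta>"
    proof
      show "(\<Sum>j<N z. w j z *\<^sub>R K' j (x j z) z) \<in> Q z"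
        using w0 w1[of z] KA[OF x \<open>z \<in> A\<close>] by (intro convex_sum cvx[OF \<open>z \<in> A\<close>]) auto
      \<comment> \<open>The derivatives of the weights sum to zero, so \<open>F z\<close> may be
        subtracted from each \<open>K j (x j z) z\<close>; no derivative of \<open>F\<close>
        enters.\<close>
      have "S' (N z) z - (\<Sum>j<N z. w j z *\<^sub>R K' j (x j z) z) = (\<Sum>j<N z. (K j (x j z) z - F z) *\<^sub>R w' j z)"
        using w'0[of z] by (simp add: S'_eq scaleR_left_diff_distrib sum_subtractf flip: scaleR_sum_right)
      also have "norm \<dots> \<le> (\<Sum>j<N z. \<delta> j * B (Suc j))"
        using KA[OF x \<open>z \<in> A\<close>] w'B \<delta> by (intro order_trans[OF norm_sum] sum_mono) (auto intro!: mult_mono simp: less_imp_le)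
      also have "\<dots> \<le> (\<Sum>j<N z. \<eta> * (1/2) ^ Suc j)" by (intro sum_mono \<delta>B)
      also have "\<dots> = \<eta> * (\<Sum>j<N z. (1/2) ^ Suc j)" by (simp only: sum_distrib_left)
      also have "\<dots> \<le> \<eta> * 1" using \<open>\<eta> > 0\<close> sum_half_powers_le[of "N z"] by (intro mult_left_mono) auto
      finally show "norm (S' (N z) z - (\<Sum>j<N z. w j z *\<^sub>R K' j (x j z) z)) \<le> \<eta>" by simp
    qed
  qed
qed

section \<open>Local approximations along a subspace\<close>

text \<open>Normalising \<open>v\<close> reduces the claim to the supremum, which is over a bounded
  set because \<open>A\<close> and \<open>B\<close> are bounded operators.\<close>

lemma dual_norm_on_bound:
  fixes A B :: "'a::real_normed_vector \<Rightarrow>\<^sub>L real"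
  assumes Y: "subspace Y" and "v \<in> Y"
  shows "\<bar>A v - B v\<bar> \<le> dual_norm_on Y (\<lambda>v. A v - B v) * norm v"
proof (cases "v = 0")
  case False
  have *: "\<bar>A w - B w\<bar> \<le> norm (A - B)" if "norm w \<le> 1" for w
    using norm_blinfun[of "A - B" w] mult_left_mono[OF that, of "norm (A - B)"]
    by (simp add: blinfun.diff_left)
  define w where "w = (1 / norm v) *\<^sub>R v"
  have w: "w \<in> Y" "norm w = 1" using False \<open>v \<in> Y\<close> Y by (auto simp: w_def subspace_scale)
  have "\<bar>A w - B w\<bar> \<le> dual_norm_on Y (\<lambda>v. A v - B v)"
    unfolding dual_norm_on_def
    by (rule cSUP_upper) (use w * in \<open>auto intro!: bdd_aboveI2\<close>)
  moreover have "A w - B w = (A v - B v) / norm v"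
    by (simp add: w_def blinfun.scaleR_right diff_divide_distrib)
  ultimately show ?thesis using False by (simp add: divide_le_eq)
qed simp

lemma dual_norm_on_le:
  assumes Y: "subspace Y" and "c \<ge> 0" and "\<And>v. v \<in> Y \<Longrightarrow> \<bar>L v\<bar> \<le> c * norm v"
  shows "dual_norm_on Y L \<le> c"
  unfolding dual_norm_on_def
proof (rule cSUP_least)
  show "{v \<in> Y. norm v \<le> 1} \<noteq> {}" using subspace_0[OF Y] by force
  fix v assume "v \<in> {v \<in> Y. norm v \<le> 1}"
  then show "\<bar>L v\<bar> \<le> c" using assms(3)[of v] mult_left_mono[of "norm v" 1 c] \<open>c \<ge> 0\<close> by auto
qed

lemma convex_near_functional:
  fixes A :: "'a::real_normed_vector \<Rightarrow>\<^sub>L real"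
  shows "convex {D :: 'a \<Rightarrow>\<^sub>L real. \<forall>v\<in>Y. \<bar>A v - D v\<bar> \<le> \<kappa> * norm v}"
proof (rule convexI, safe)
  fix D E :: "'a \<Rightarrow>\<^sub>L real" and a b :: real and v
  assume *: "\<forall>v\<in>Y. \<bar>A v - D v\<bar> \<le> \<kappa> * norm v" "\<forall>v\<in>Y. \<bar>A v - E v\<bar> \<le> \<kappa> * norm v"
    "0 \<le> a" "0 \<le> b" "a + b = 1" "v \<in> Y"
  have "A v = (a + b) * A v" using *(5) by simp
  then have "A v - (a *\<^sub>R D + b *\<^sub>R E) v = a * (A v - D v) + b * (A v - E v)"
    by (simp add: blinfun.add_left blinfun.scaleR_left algebra_simps)
  also have "\<bar>\<dots>\<bar> \<le> a * \<bar>A v - D v\<bar> + b * \<bar>A v - E v\<bar>"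
    using abs_triangle_ineq[of "a * (A v - D v)" "b * (A v - E v)"] *(3,4) by (simp add: abs_mult)
  also have "\<dots> \<le> a * (\<kappa> * norm v) + b * (\<kappa> * norm v)"
    using * by (intro add_mono mult_left_mono) auto
  also have "\<dots> = (a + b) * (\<kappa> * norm v)" by (rule distrib_right[symmetric])
  finally show "\<bar>A v - (a *\<^sub>R D + b *\<^sub>R E) v\<bar> \<le> \<kappa> * norm v" using *(5) by simp
qed

text \<open>The mean value inequality along segments in \<open>Y\<close> within the ball. Any
  \<open>\<tau>\<close> extending \<open>f' y\<close> from \<open>Y\<close> is allowed, which leaves
  room for a norm-preserving one.\<close>

lemma C1_deriv_on_locally_affine:
  assumes Y: "subspace Y" and f: "C1_deriv_on Y f f'" and y: "y \<in> Y" and "\<eta> > 0"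
  obtains r where "r > 0"
    "\<And>z v. z \<in> Y \<Longrightarrow> dist y z < r \<Longrightarrow> v \<in> Y \<Longrightarrow> \<bar>f' z v - f' y v\<bar> \<le> \<eta> * norm v"
    "\<And>\<tau>. (\<And>v. v \<in> Y \<Longrightarrow> blinfun_apply \<tau> v = f' y v) \<Longrightarrow> \<eta>-lipschitz_on (Y \<inter> ball y r) (\<lambda>x. f x - \<tau> x)"
proof -
  obtain r where r: "r > 0" and
    dn: "\<And>z. z \<in> Y \<Longrightarrow> dist z y < r \<Longrightarrow> dual_norm_on Y (\<lambda>v. f' z v - f' y v) < \<eta>"
    using f y \<open>\<eta> > 0\<close> unfolding C1_deriv_on_def by blast
  have near: "\<bar>f' z v - f' y v\<bar> \<le> \<eta> * norm v" if "z \<in> Y" "dist y z < r" "v \<in> Y" for z v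
  proof -
    have "dual_norm_on Y (\<lambda>v. f' z v - f' y v) * norm v \<le> \<eta> * norm v"
      using dn[of z] that by (intro mult_right_mono) (auto simp: dist_commute)
    then show ?thesis using dual_norm_on_bound[OF Y that(3), of "f' z" "f' y"] by linarith
  qed
  have "\<eta>-lipschitz_on (Y \<inter> ball y r) (\<lambda>x. f x - \<tau> x)"
    if \<tau>: "\<And>v. v \<in> Y \<Longrightarrow> blinfun_apply \<tau> v = f' y v" for \<tau>
  proof (rule lipschitz_onI)
    fix a b assume a: "a \<in> Y \<inter> ball y r" and b: "b \<in> Y \<inter> ball y r"
    define \<gamma> where "\<gamma> t = a + t *\<^sub>R (b - a)" for t
    have "b - a \<in> Y" using a b Y by (simp add: subspace_diff)
    have "convex (Y \<inter> ball y r)" by (rule convex_Int[OF subspace_imp_convex[OF Y] convex_ball])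
    then have \<gamma>: "\<gamma> t \<in> Y \<inter> ball y r" if "t \<in> {0..1}" for t
      using convexD_alt[OF _ a b, of t] that by (simp add: \<gamma>_def algebra_simps)
    have D: "((\<lambda>t. f (\<gamma> t) - \<tau> (\<gamma> t)) has_real_derivative f' (\<gamma> t) (b - a) - \<tau> (b - a)) (at t within {0..1})"
      if t: "t \<in> {0..1}" for t
    proof -
      have "((\<lambda>x. f x - \<tau> x) has_derivative (\<lambda>v. f' (\<gamma> t) v - \<tau> v)) (at (\<gamma> t) within Y)"
        using f \<gamma>[OF t] unfolding C1_deriv_on_def
        by (intro has_derivative_diff bounded_linear_imp_has_derivative blinfun.bounded_linear_right) auto
      \<comment> \<open>Differentiability of \<open>f\<close> is given within \<open>Y\<close> and
        is restricted to the segment, which lies in \<open>Y\<close>.\<close>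
      then have "((\<lambda>x. f x - \<tau> x) has_derivative (\<lambda>v. f' (\<gamma> t) v - \<tau> v)) (at (\<gamma> t) within \<gamma> ` {0..1})"
        by (rule has_derivative_subset) (use \<gamma> in blast)
      moreover have "(\<gamma> has_derivative (\<lambda>h. h *\<^sub>R (b - a))) (at t within {0..1})"
        unfolding \<gamma>_def[abs_def] by (auto intro!: derivative_eq_intros)
      ultimately have "((\<lambda>t. f (\<gamma> t) - \<tau> (\<gamma> t)) has_derivative
          (\<lambda>h. f' (\<gamma> t) (h *\<^sub>R (b - a)) - \<tau> (h *\<^sub>R (b - a)))) (at t within {0..1})"
        using has_derivative_in_compose[of \<gamma> "\<lambda>h. h *\<^sub>R (b - a)" t "{0..1}" "\<lambda>x. f x - \<tau> x"
            "\<lambda>v. f' (\<gamma> t) v - \<tau> v"] by blast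
      then show ?thesis unfolding has_field_derivative_def
        by (rule has_derivative_eq_rhs) (auto simp: blinfun.scaleR_right right_diff_distrib mult.commute simp del: scaleR_diff_right)
    qed
    have "\<bar>f' (\<gamma> t) (b - a) - \<tau> (b - a)\<bar> \<le> \<eta> * norm (b - a)" if "t \<in> {0..1}" for t
      using near[of "\<gamma> t" "b - a"] \<gamma>[OF that] \<tau>[OF \<open>b - a \<in> Y\<close>] \<open>b - a \<in> Y\<close> by auto
    then have "norm ((f (\<gamma> 1) - \<tau> (\<gamma> 1)) - (f (\<gamma> 0) - \<tau> (\<gamma> 0))) \<le> \<eta> * norm (b - a) * norm (1 - 0 :: real)"
      using D by (intro field_differentiable_bound[where S = "{0..1}"]) auto
    then show "dist (f a - \<tau> a) (f b - \<tau> b) \<le> \<eta> * dist a b"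
      by (simp add: \<gamma>_def dist_norm norm_minus_commute abs_minus_commute)
  qed (use \<open>\<eta> > 0\<close> in simp)
  then show ?thesis using that r near by blast
qed

text \<open>Both \<open>e\<close> and \<open>k\<close> are kept: \<open>e\<close> is exact on
  \<open>S\<close>, \<open>k\<close> is smooth, and the bound on \<open>k'\<close> does not depend
  on \<open>\<delta>\<close>.\<close>

lemma smooth_extension:
  fixes h :: "'a::real_normed_vector \<Rightarrow> real"
  assumes C: "smoothing_constant TYPE('a) C" and "\<delta> > 0"
    and h: "\<eta>-lipschitz_on S h"
  obtains e k k' where "\<eta>-lipschitz_on UNIV e" "\<And>z. z \<in> S \<Longrightarrow> e z = h z"
    "has_C1_derivative k k'" "\<And>x. \<bar>e x - k x\<bar> < \<delta>" "\<And>x. norm (k' x) \<le> C * \<eta>"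
proof -
  obtain e where e: "\<eta>-lipschitz_on UNIV e" "\<And>x. x \<in> S \<Longrightarrow> e x = h x"
    using McShane_extension[OF h] by blast
  show ?thesis by (rule smoothing_constantE[OF C e(1) \<open>\<delta> > 0\<close>]) (rule that[OF e])
qed

text \<open>At a point of \<open>Y\<close> the approximant is \<open>\<tau> + k\<close>. On
  \<open>Y\<close> its error is just that of smoothing, hence as small as desired; off
  \<open>Y\<close> continuity of \<open>F\<close> gives the fixed error
  \<open>\<epsilon>\<close>.\<close>

lemma local_approximation_of_continuous:
  fixes f F :: "'a::real_normed_vector \<Rightarrow> real"
  assumes C: "smoothing_constant TYPE('a) C" and Y: "subspace Y" "closed Y"
    and f: "C1_deriv_on Y f f'" and F: "continuous_on UNIV F" "\<And>y. y \<in> Y \<Longrightarrow> F y = f y"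
    and "\<epsilon> > 0" "\<kappa> > 0"
  shows "\<exists>r>0. \<forall>\<delta>>0. \<exists>K K'. has_C1_derivative K K' \<and>
    (\<forall>z\<in>ball x r. \<bar>K z - F z\<bar> \<le> \<epsilon> \<and>
      (z \<in> Y \<longrightarrow> \<bar>K z - F z\<bar> \<le> \<delta> \<and> K' z \<in> {D :: 'a \<Rightarrow>\<^sub>L real. \<forall>v\<in>Y. \<bar>f' z v - D v\<bar> \<le> \<kappa> * norm v}))"
proof -
  have "isCont F x" using F(1) by (simp add: continuous_on_eq_continuous_at)
  then obtain r1 where r1: "r1 > 0" "\<And>z. dist x z < r1 \<Longrightarrow> \<bar>F z - F x\<bar> < \<epsilon> / 4"
    using \<open>\<epsilon> > 0\<close> unfolding continuous_at_eps_delta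
    by (metis dist_commute dist_real_def zero_less_divide_iff zero_less_numeral)
  show ?thesis
  proof (cases "x \<in> Y")
    \<comment> \<open>A ball missing the closed set \<open>Y\<close> makes the conditions on
      \<open>Y\<close> vacuous, so a constant suffices.\<close>
    case False
    then obtain r2 where r2: "r2 > 0" "ball x r2 \<subseteq> - Y"
      using Y(2) open_contains_ball[of "- Y"] by (auto simp: closed_def)
    have "\<forall>z\<in>ball x (min r1 r2). \<bar>F x - F z\<bar> \<le> \<epsilon> \<and> z \<notin> Y"
      using r1 r2 \<open>\<epsilon> > 0\<close> by (force simp: abs_minus_commute)
    then show ?thesis using r1 r2 has_C1_derivative_const[of "F x"]
      by (intro exI[of _ "min r1 r2"] conjI allI impI exI[of _ "\<lambda>z. F x"] exI[of _ "\<lambda>z. 0"]) auto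
  next
    case x: True
    have "C \<ge> 0" using C by (simp add: smoothing_constant_def)
    \<comment> \<open>Splits \<open>\<kappa>\<close> into \<open>\<eta>\<close> for the variation of
      \<open>f'\<close> and \<open>C * \<eta>\<close> for the derivative of the smoothed
      correction.\<close>
    define \<eta> where "\<eta> = \<kappa> / (1 + C)"
    have "\<eta> * (1 + C) = \<kappa>" using \<open>C \<ge> 0\<close> by (simp add: \<eta>_def)
    then have \<eta>: "\<eta> > 0" "\<eta> + C * \<eta> = \<kappa>"
      using \<open>\<kappa> > 0\<close> \<open>C \<ge> 0\<close> by (simp add: \<eta>_def, simp add: distrib_left mult.commute)
    define \<tau> where "\<tau> = f' x"
    obtain r0 where r0: "r0 > 0"
      "\<And>z v. z \<in> Y \<Longrightarrow> dist x z < r0 \<Longrightarrow> v \<in> Y \<Longrightarrow> \<bar>f' z v - \<tau> v\<bar> \<le> \<eta> * norm v"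
      "\<eta>-lipschitz_on (Y \<inter> ball x r0) (\<lambda>z. f z - \<tau> z)"
      using C1_deriv_on_locally_affine[OF Y(1) f x \<eta>(1)] unfolding \<tau>_def by metis
    \<comment> \<open>Makes \<open>\<tau> + e\<close> vary by at most \<open>\<epsilon> / 4\<close>
      on the ball; positive \<open>\<eta>\<close> guards against \<open>\<tau> = 0\<close>.\<close>
    define r2 where "r2 = \<epsilon> / 4 / (norm \<tau> + \<eta>)"
    have pos: "norm \<tau> + \<eta> > 0" using \<eta>(1) by (simp add: add_nonneg_pos)
    then have "r2 > 0" using \<open>\<epsilon> > 0\<close> by (simp add: r2_def)
    have "(norm \<tau> + \<eta>) * r2 = \<epsilon> / 4"
      using pos by (subst mult.commute, intro iffD1[OF nonzero_eq_divide_eq r2_def]) simp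
    define r where "r = min r0 (min r1 r2)"
    have "r > 0" using r0 r1 \<open>r2 > 0\<close> by (simp add: r_def)
    have "\<exists>K K'. has_C1_derivative K K' \<and>
    (\<forall>z\<in>ball x r. \<bar>K z - F z\<bar> \<le> \<epsilon> \<and>
      (z \<in> Y \<longrightarrow> \<bar>K z - F z\<bar> \<le> \<delta> \<and> K' z \<in> {D :: 'a \<Rightarrow>\<^sub>L real. \<forall>v\<in>Y. \<bar>f' z v - D v\<bar> \<le> \<kappa> * norm v}))"
      if "\<delta> > 0" for \<delta>
    proof -
      have "min \<delta> (\<epsilon> / 4) > 0" using that \<open>\<epsilon> > 0\<close> by simp
      obtain e k k' where e: "\<eta>-lipschitz_on UNIV e" "\<And>z. z \<in> Y \<inter> ball x r0 \<Longrightarrow> e z = f z - \<tau> z"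
        and k: "has_C1_derivative k k'" "\<And>z. \<bar>e z - k z\<bar> < min \<delta> (\<epsilon> / 4)" "\<And>z. norm (k' z) \<le> C * \<eta>"
        using smooth_extension[OF C \<open>min \<delta> (\<epsilon> / 4) > 0\<close> r0(3)] by blast
      show ?thesis
      proof (intro exI conjI ballI impI CollectI)
        show "has_C1_derivative (\<lambda>z. \<tau> z + k z) (\<lambda>z. \<tau> + k' z)"
          by (intro has_C1_derivative_add has_C1_derivative_blinfun k)
        fix z assume z: "z \<in> ball x r"
        have "\<bar>\<tau> z - \<tau> x\<bar> \<le> norm \<tau> * dist x z"
          using norm_blinfun[of \<tau> "z - x"] by (simp add: blinfun.diff_right dist_norm norm_minus_commute)
        moreover have "\<bar>e z - e x\<bar> \<le> \<eta> * dist x z"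
          using lipschitz_onD[OF e(1), of z x] by (simp add: dist_real_def dist_commute)
        moreover have "(norm \<tau> + \<eta>) * dist x z \<le> (norm \<tau> + \<eta>) * r2"
          using z pos by (intro mult_left_mono) (auto simp: r_def)
        then have "norm \<tau> * dist x z + \<eta> * dist x z \<le> \<epsilon> / 4"
          unfolding \<open>(norm \<tau> + \<eta>) * r2 = \<epsilon> / 4\<close> by (simp only: distrib_right)
        moreover have "e x = F x - \<tau> x" using e(2)[of x] F(2)[OF x] x r0(1) by simp
        moreover have "\<bar>F z - F x\<bar> < \<epsilon> / 4" using r1(2)[of z] z by (simp add: r_def)
        moreover have "\<bar>e z - k z\<bar> < \<epsilon> / 4" using k(2)[of z] by simp
        ultimately show "\<bar>\<tau> z + k z - F z\<bar> \<le> \<epsilon>" by linarith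
        assume "z \<in> Y"
        then have "e z = F z - \<tau> z" using e(2)[of z] F(2) z by (simp add: r_def)
        then show "\<bar>\<tau> z + k z - F z\<bar> \<le> \<delta>" using k(2)[of z] by linarith
        fix v assume "v \<in> Y"
        then have "\<bar>f' z v - \<tau> v\<bar> \<le> \<eta> * norm v" using r0(2)[OF \<open>z \<in> Y\<close>] z by (simp add: r_def)
        moreover have "\<bar>k' z v\<bar> \<le> C * \<eta> * norm v"
          using norm_blinfun[of "k' z" v] mult_right_mono[OF k(3)[of z], of "norm v"] by simp
        moreover have "\<kappa> * norm v = \<eta> * norm v + C * \<eta> * norm v" by (simp flip: \<eta>(2) add: distrib_right)
        ultimately show "\<bar>f' z v - (\<tau> + k' z) v\<bar> \<le> \<kappa> * norm v"
          unfolding blinfun.add_left by linarith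
      qed
    qed
    then show ?thesis using \<open>r > 0\<close> by blast
  qed
qed

text \<open>The function \<open>\<tau> + k\<close> is close to \<open>F\<close> only on \<open>Y\<close>. The correction \<open>N\<close> smooths the
  difference and then flattens the values near zero, so that \<open>N\<close> repairs the approximation
  off \<open>Y\<close> while its derivative vanishes on \<open>Y\<close>.\<close>

lemma local_approximation_of_lipschitz:
  fixes F :: "'a::real_normed_vector \<Rightarrow> real"
  assumes C: "smoothing_constant TYPE('a) C" and Y: "subspace Y" "closed Y"
    and f: "C1_deriv_on Y f f'" and F: "M-lipschitz_on UNIV F" "\<And>y. y \<in> Y \<Longrightarrow> F y = f y"
    and "M > 0" "\<kappa> > 0"
  shows "\<exists>r>0. \<forall>\<delta>>0. \<exists>K K'. has_C1_derivative K K' \<and>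
    (\<forall>z\<in>ball x r. \<bar>K z - F z\<bar> \<le> \<delta> \<and> norm (K' z) \<le> (1 + 3 * C + C\<^sup>2) * M \<and>
      (z \<in> Y \<longrightarrow> (\<forall>v\<in>Y. \<bar>f' z v - K' z v\<bar> \<le> \<kappa> * norm v)))"
proof -
  have "C \<ge> 0" using C by (simp add: smoothing_constant_def)
  have CM: "C * M \<ge> 0" "C * (C * M) \<ge> 0" using \<open>C \<ge> 0\<close> \<open>M > 0\<close> by auto
  have C2M: "(1 + 3 * C + C\<^sup>2) * M = M + 3 * (C * M) + C * (C * M)"
    by (simp add: algebra_simps power2_eq_square)
  show ?thesis
  proof (cases "x \<in> Y")
    case False
    then obtain r where r: "r > 0" "ball x r \<subseteq> - Y"
      using Y(2) open_contains_ball[of "- Y"] by (auto simp: closed_def)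
    have "\<exists>K K'. has_C1_derivative K K' \<and>
      (\<forall>z\<in>ball x r. \<bar>K z - F z\<bar> \<le> \<delta> \<and> norm (K' z) \<le> (1 + 3 * C + C\<^sup>2) * M \<and>
      (z \<in> Y \<longrightarrow> (\<forall>v\<in>Y. \<bar>f' z v - K' z v\<bar> \<le> \<kappa> * norm v)))" if \<delta>: "\<delta> > 0" for \<delta>
    proof -
      obtain K K' where K: "has_C1_derivative K K'" "\<And>z. \<bar>F z - K z\<bar> < \<delta>" "\<And>z. norm (K' z) \<le> C * M"
        using smoothing_constantE[OF C F(1) \<delta>] by blast
      have "norm (K' z) \<le> (1 + 3 * C + C\<^sup>2) * M" for z
        using K(3)[of z] CM \<open>M > 0\<close> unfolding C2M by linarith
      moreover have "\<bar>K z - F z\<bar> \<le> \<delta>" for z using K(2)[of z] by linarith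
      ultimately show ?thesis using K(1) r(2) by blast
    qed
    then show ?thesis using r(1) by blast
  next
    case x: True
    \<comment> \<open>The cap by \<open>M\<close> makes the derivative of \<open>k\<close> at most
      \<open>C * M\<close>, whatever \<open>\<kappa>\<close> is.\<close>
    define \<eta> where "\<eta> = min M (\<kappa> / (1 + C))"
    have "\<eta> > 0" using \<open>\<kappa> > 0\<close> \<open>C \<ge> 0\<close> \<open>M > 0\<close> by (simp add: \<eta>_def)
    have "\<eta> \<le> M" by (simp add: \<eta>_def)
    have "\<eta> * (1 + C) \<le> \<kappa> / (1 + C) * (1 + C)"
      using \<open>C \<ge> 0\<close> by (intro mult_right_mono) (auto simp: \<eta>_def)
    also have "\<dots> = \<kappa>" using \<open>C \<ge> 0\<close> by simp
    finally have \<eta>\<kappa>: "\<eta> + C * \<eta> \<le> \<kappa>" by (simp add: distrib_left mult.commute)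
    have C\<eta>: "C * \<eta> \<le> C * M" using \<open>C \<ge> 0\<close> \<open>\<eta> \<le> M\<close> by (rule mult_left_mono[rotated])
    have "M-lipschitz_on Y f"
      by (rule lipschitz_on_transform[OF lipschitz_on_subset[OF F(1)]]) (simp_all add: F(2))
    then have "\<bar>f' x v\<bar> \<le> M * norm v" if "v \<in> Y" for v
      using f x that Y(1) unfolding C1_deriv_on_def by (blast intro: lipschitz_derivative_bound)
    then obtain \<tau> :: "'a \<Rightarrow>\<^sub>L real" where \<tau>: "norm \<tau> \<le> M" "\<And>v. v \<in> Y \<Longrightarrow> \<tau> v = f' x v"
      using Hahn_Banach_blinfun[OF Y(1), of M "f' x"] \<open>M > 0\<close> by (metis less_imp_le)
    obtain r where r: "r > 0"
      "\<And>z v. z \<in> Y \<Longrightarrow> dist x z < r \<Longrightarrow> v \<in> Y \<Longrightarrow> \<bar>f' z v - f' x v\<bar> \<le> \<eta> * norm v"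
      "\<eta>-lipschitz_on (Y \<inter> ball x r) (\<lambda>z. f z - \<tau> z)"
      using C1_deriv_on_locally_affine[OF Y(1) f x \<open>\<eta> > 0\<close>] \<tau>(2) by metis
    have "\<exists>K K'. has_C1_derivative K K' \<and>
      (\<forall>z\<in>ball x r. \<bar>K z - F z\<bar> \<le> \<delta> \<and> norm (K' z) \<le> (1 + 3 * C + C\<^sup>2) * M \<and>
      (z \<in> Y \<longrightarrow> (\<forall>v\<in>Y. \<bar>f' z v - K' z v\<bar> \<le> \<kappa> * norm v)))" if "\<delta> > 0" for \<delta>
    proof -
      have d: "\<delta> / 4 > 0" using that by simp
      obtain e k k' where e: "\<And>z. z \<in> Y \<inter> ball x r \<Longrightarrow> e z = f z - \<tau> z"
        and k: "has_C1_derivative k k'" "\<And>z. \<bar>e z - k z\<bar> < \<delta> / 4" "\<And>z. norm (k' z) \<le> C * \<eta>"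
        using smooth_extension[OF C d r(3)] by metis
      have "M-lipschitz_on UNIV \<tau>"
        using C1_lipschitz_iff[OF has_C1_derivative_blinfun[of \<tau>], of M] \<tau>(1) \<open>M > 0\<close>
        by (blast intro: less_imp_le)
      moreover have "(C * M)-lipschitz_on UNIV k"
        using C1_lipschitz_iff[OF k(1) CM(1)] k(3) C\<eta> order_trans by blast
      ultimately have "(M + (M + C * M))-lipschitz_on UNIV (\<lambda>z. F z - (\<tau> z + k z))"
        by (intro lipschitz_on_diff lipschitz_on_add F(1))
      then obtain n n' where n: "has_C1_derivative n n'" "\<And>z. \<bar>F z - (\<tau> z + k z) - n z\<bar> < \<delta> / 4"
        "\<And>z. norm (n' z) \<le> C * (M + (M + C * M))"
        using smoothing_constantE[OF C _ d] by blast
      obtain \<theta> \<theta>' :: "real \<Rightarrow> real" where \<theta>: "\<And>t. (\<theta> has_real_derivative \<theta>' t) (at t)" "continuous_on UNIV \<theta>'"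
        and \<theta>0: "\<And>t. \<bar>t\<bar> \<le> 2 * (\<delta> / 4) \<Longrightarrow> \<theta>' t = 0" "\<And>t. \<bar>\<theta> t - t\<bar> \<le> 3 * (\<delta> / 4)" "\<And>t. \<bar>\<theta>' t\<bar> \<le> 1"
        using smooth_dead_zone[OF d] by blast
      show ?thesis
      proof (intro exI conjI ballI impI)
        show "has_C1_derivative (\<lambda>z. (\<tau> z + k z) + \<theta> (n z)) (\<lambda>z. (\<tau> + k' z) + \<theta>' (n z) *\<^sub>R n' z)"
          by (intro has_C1_derivative_add has_C1_derivative_blinfun k n has_C1_derivative_compose \<theta>)
        fix z assume z: "z \<in> ball x r"
        show "\<bar>\<tau> z + k z + \<theta> (n z) - F z\<bar> \<le> \<delta>"
          using n(2)[of z] \<theta>0(2)[of "n z"] by linarith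
        \<comment> \<open>The contributions are \<open>M\<close> from \<open>\<tau>\<close>,
          \<open>C * M\<close> from \<open>k\<close> and \<open>C * (2 * M + C * M)\<close> from the
          correction, which explains the constant \<open>1 + 3 * C + C\<^sup>2\<close>.\<close>
        have "norm (\<theta>' (n z) *\<^sub>R n' z) \<le> 1 * (C * (M + (M + C * M)))"
          unfolding norm_scaleR real_norm_def using n(3)[of z] \<theta>0(3)[of "n z"] by (intro mult_mono) auto
        then have "norm (\<tau> + k' z + \<theta>' (n z) *\<^sub>R n' z) \<le> M + C * M + C * (M + (M + C * M))"
          using \<tau>(1) order_trans[OF k(3)[of z] C\<eta>]
          by (intro norm_triangle_le add_mono) auto
        then show "norm (\<tau> + k' z + \<theta>' (n z) *\<^sub>R n' z) \<le> (1 + 3 * C + C\<^sup>2) * M"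
          unfolding C2M by (simp add: algebra_simps)
        fix v assume "z \<in> Y" "v \<in> Y"
        have "e z = F z - \<tau> z" using e[of z] F(2)[of z] z \<open>z \<in> Y\<close> by simp
        \<comment> \<open>On \<open>Y\<close> the function \<open>\<tau> + k\<close> is within
          \<open>\<delta> / 4\<close> of \<open>F\<close>, so \<open>n z\<close> is below
          \<open>\<delta> / 2\<close> in modulus and falls in the dead zone.\<close>
        then have "\<theta>' (n z) = 0" using n(2)[of z] k(2)[of z] by (intro \<theta>0(1)) linarith
        moreover have "\<bar>f' z v - \<tau> v\<bar> \<le> \<eta> * norm v"
          using r(2)[OF \<open>z \<in> Y\<close> _ \<open>v \<in> Y\<close>] z \<tau>(2)[OF \<open>v \<in> Y\<close>] by simp
        moreover have "\<bar>k' z v\<bar> \<le> C * \<eta> * norm v"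
          using norm_blinfun[of "k' z" v] mult_right_mono[OF k(3)[of z], of "norm v"] by simp
        moreover have "\<eta> * norm v + C * \<eta> * norm v \<le> \<kappa> * norm v"
          using mult_right_mono[OF \<eta>\<kappa>, of "norm v"] by (simp add: distrib_right)
        ultimately show "\<bar>f' z v - (\<tau> + k' z + \<theta>' (n z) *\<^sub>R n' z) v\<bar> \<le> \<kappa> * norm v"
          unfolding blinfun.add_left blinfun.scaleR_left by simp
      qed
    qed
    then show ?thesis using r(1) by blast
  qed
qed

lemma dual_norm_on_near_less:
  fixes A D G :: "'a::real_normed_vector \<Rightarrow>\<^sub>L real"
  assumes Y: "subspace Y" and D: "\<And>v. v \<in> Y \<Longrightarrow> \<bar>A v - D v\<bar> \<le> \<kappa> * norm v"
    and G: "norm (G - D) \<le> \<eta>" and "0 \<le> \<kappa>" "\<kappa> + \<eta> < \<epsilon>"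
  shows "dual_norm_on Y (\<lambda>v. A v - G v) < \<epsilon>"
proof -
  have "\<eta> \<ge> 0" using G norm_ge_zero order_trans by blast
  have "dual_norm_on Y (\<lambda>v. A v - G v) \<le> \<kappa> + \<eta>"
  proof (rule dual_norm_on_le[OF Y])
    fix v assume "v \<in> Y"
    have "\<bar>G v - D v\<bar> \<le> \<eta> * norm v"
      using norm_blinfun[of "G - D" v] mult_right_mono[OF G, of "norm v"] by (simp add: blinfun.diff_left)
    then show "\<bar>A v - G v\<bar> \<le> (\<kappa> + \<eta>) * norm v" using D[OF \<open>v \<in> Y\<close>] by (simp add: distrib_right)
  qed (use \<open>\<eta> \<ge> 0\<close> \<open>0 \<le> \<kappa>\<close> in simp)
  then show ?thesis using assms(5) by linarith
qed

section \<open>The approximation theorem\<close>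

text \<open>Gluing with \<open>A = Y\<close>: away from \<open>Y\<close> nothing is asked of the
  derivative.\<close>

lemma C1_fine_approximation_continuous:
  fixes F :: "'a::real_normed_vector \<Rightarrow> real"
  assumes C: "smoothing_constant TYPE('a) C" and Y: "subspace Y" "closed Y"
    and f: "C1_deriv_on Y f f'" and F: "continuous_on UNIV F" "\<And>y. y \<in> Y \<Longrightarrow> F y = f y"
    and "\<epsilon> > 0"
  obtains G G' where "has_C1_derivative G G'" "\<And>x. \<bar>F x - G x\<bar> < \<epsilon>"
    "\<And>y. y \<in> Y \<Longrightarrow> dual_norm_on Y (\<lambda>v. f' y v - G' y v) < \<epsilon>"
proof -
  define Q where "Q z = {D :: 'a \<Rightarrow>\<^sub>L real. \<forall>v\<in>Y. \<bar>f' z v - D v\<bar> \<le> \<epsilon> / 4 * norm v}" for z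
  have e: "\<epsilon> / 2 > 0" "\<epsilon> / 4 > 0" using \<open>\<epsilon> > 0\<close> by auto
  have cvx: "convex (Q z)" for z unfolding Q_def by (rule convex_near_functional)
  obtain G G' where G: "has_C1_derivative G G'" "\<And>z. \<bar>G z - F z\<bar> \<le> \<epsilon> / 2"
    and G': "\<And>z. z \<in> Y \<Longrightarrow> \<exists>q\<in>Q z. norm (G' z - q) \<le> \<epsilon> / 4"
    using C1_glue[where A = Y and Q = Q and F = F and \<epsilon> = "\<epsilon> / 2", OF C e(2) cvx
        local_approximation_of_continuous[OF C Y f F e, folded Q_def]] by metis
  show ?thesis
  proof (rule that[OF G(1)])
    show "\<bar>F x - G x\<bar> < \<epsilon>" for x using G(2)[of x] \<open>\<epsilon> > 0\<close> by linarith
    fix y assume "y \<in> Y"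
    from G'[OF this] obtain q where q: "q \<in> Q y" "norm (G' y - q) \<le> \<epsilon> / 4" by blast
    show "dual_norm_on Y (\<lambda>v. f' y v - G' y v) < \<epsilon>"
      by (rule dual_norm_on_near_less[OF Y(1) _ q(2), where \<kappa> = "\<epsilon> / 4"])
        (use q(1) \<open>\<epsilon> > 0\<close> in \<open>simp_all add: Q_def\<close>)
  qed
qed

text \<open>Gluing with \<open>A = UNIV\<close>, so that the derivative is controlled everywhere and
  a global Lipschitz bound results.\<close>

lemma C1_fine_approximation_lipschitz:
  fixes F :: "'a::real_normed_vector \<Rightarrow> real"
  assumes C: "smoothing_constant TYPE('a) C" and Y: "subspace Y" "closed Y"
    and f: "C1_deriv_on Y f f'" and F: "M-lipschitz_on UNIV F" "\<And>y. y \<in> Y \<Longrightarrow> F y = f y"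
    and "\<epsilon> > 0"
  obtains G G' where "has_C1_derivative G G'" "\<And>x. \<bar>F x - G x\<bar> < \<epsilon>"
    "\<And>y. y \<in> Y \<Longrightarrow> dual_norm_on Y (\<lambda>v. f' y v - G' y v) < \<epsilon>"
    "((2 + 3 * C + C\<^sup>2) * M)-lipschitz_on UNIV G"
proof (cases "M = 0")
  \<comment> \<open>A constant \<open>F\<close> is its own approximant. In the other case
    \<open>M > 0\<close> allows \<open>M\<close> as a cap on the gluing error.\<close>
  case True
  have const: "F = (\<lambda>x. F 0)"
    using lipschitz_onD[OF F(1)] by (force simp: True)
  have "M-lipschitz_on Y f"
    by (rule lipschitz_on_transform[OF lipschitz_on_subset[OF F(1)]]) (simp_all add: F(2))
  then have f'0: "\<bar>f' y v\<bar> \<le> M * norm v" if "y \<in> Y" "v \<in> Y" for y v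
    using f that Y(1) unfolding C1_deriv_on_def by (blast intro: lipschitz_derivative_bound)
  show ?thesis
  proof (rule that[of F "\<lambda>x. 0"])
    show "has_C1_derivative F (\<lambda>x. 0)" by (subst const) (rule has_C1_derivative_const)
    show "dual_norm_on Y (\<lambda>v. f' y v - blinfun_apply 0 v) < \<epsilon>" if "y \<in> Y" for y
      using f'0[OF that] \<open>\<epsilon> > 0\<close> True
      by (intro dual_norm_on_near_less[OF Y(1), of _ 0 0 _ 0]) (auto simp: zero_blinfun.rep_eq)
    show "((2 + 3 * C + C\<^sup>2) * M)-lipschitz_on UNIV F" using F(1) by (simp add: True)
  qed (use \<open>\<epsilon> > 0\<close> in simp)
next
  case False
  then have M: "M > 0" using lipschitz_on_nonneg[OF F(1)] by simp
  define Q where "Q z = {D :: 'a \<Rightarrow>\<^sub>L real. norm D \<le> (1 + 3 * C + C\<^sup>2) * M} \<inter>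
      (if z \<in> Y then {D :: 'a \<Rightarrow>\<^sub>L real. \<forall>v\<in>Y. \<bar>f' z v - D v\<bar> \<le> \<epsilon> / 4 * norm v} else UNIV)" for z
  \<comment> \<open>The cap by \<open>M\<close> costs one further \<open>M\<close> in the norm of
    \<open>G'\<close>, raising the leading 1 of the constant to 2.\<close>
  define \<eta> where "\<eta> = min M (\<epsilon> / 4)"
  have e: "\<epsilon> / 2 > 0" "\<epsilon> / 4 > 0" "\<eta> > 0" using \<open>\<epsilon> > 0\<close> M by (auto simp: \<eta>_def)
  have "{D :: 'a \<Rightarrow>\<^sub>L real. norm D \<le> c} = cball 0 c" for c by auto
  then have cvx: "convex (Q z)" for z unfolding Q_def
    by (intro convex_Int) (simp_all add: convex_near_functional
        del: divide_le_eq_numeral1 le_divide_eq_numeral1 times_divide_eq_left)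
  have "\<exists>r>0. \<forall>\<delta>>0. \<exists>K K'. has_C1_derivative K K' \<and>
      (\<forall>z\<in>ball x r. \<bar>K z - F z\<bar> \<le> \<epsilon> / 2 \<and> (z \<in> UNIV \<longrightarrow> \<bar>K z - F z\<bar> \<le> \<delta> \<and> K' z \<in> Q z))" for x
  proof -
    obtain r where r: "r > 0" and ex: "\<And>\<delta>. \<delta> > 0 \<Longrightarrow> \<exists>K K'. has_C1_derivative K K' \<and>
    (\<forall>z\<in>ball x r. \<bar>K z - F z\<bar> \<le> \<delta> \<and> norm (K' z) \<le> (1 + 3 * C + C\<^sup>2) * M \<and>
      (z \<in> Y \<longrightarrow> (\<forall>v\<in>Y. \<bar>f' z v - K' z v\<bar> \<le> \<epsilon> / 4 * norm v)))"
      using local_approximation_of_lipschitz[OF C Y f F M e(2)] by blast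
    have "\<exists>K K'. has_C1_derivative K K' \<and>
      (\<forall>z\<in>ball x r. \<bar>K z - F z\<bar> \<le> \<epsilon> / 2 \<and> (z \<in> UNIV \<longrightarrow> \<bar>K z - F z\<bar> \<le> \<delta> \<and> K' z \<in> Q z))"
      if "\<delta> > 0" for \<delta>
    proof -
      obtain K K' where "has_C1_derivative K K'"
        "\<forall>z\<in>ball x r. \<bar>K z - F z\<bar> \<le> min \<delta> (\<epsilon> / 2) \<and> norm (K' z) \<le> (1 + 3 * C + C\<^sup>2) * M \<and>
      (z \<in> Y \<longrightarrow> (\<forall>v\<in>Y. \<bar>f' z v - K' z v\<bar> \<le> \<epsilon> / 4 * norm v))"
        using ex[of "min \<delta> (\<epsilon> / 2)"] \<open>\<delta> > 0\<close> e(1) by auto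
      then show ?thesis unfolding Q_def by (intro exI[of _ K] exI[of _ K']) auto
    qed
    then show ?thesis using r by blast
  qed
  from C1_glue[where A = UNIV and Q = Q and F = F and \<epsilon> = "\<epsilon> / 2", OF C e(3) cvx this]
  obtain G G' where G: "has_C1_derivative G G'" "\<And>z. \<bar>G z - F z\<bar> \<le> \<epsilon> / 2"
    and G': "\<And>z. \<exists>q\<in>Q z. norm (G' z - q) \<le> \<eta>"
    by (metis UNIV_I)
  show ?thesis
  proof (rule that[OF G(1)])
    show "\<bar>F x - G x\<bar> < \<epsilon>" for x using G(2)[of x] \<open>\<epsilon> > 0\<close> by linarith
    show "dual_norm_on Y (\<lambda>v. f' y v - G' y v) < \<epsilon>" if "y \<in> Y" for y
    proof -
      obtain q where q: "q \<in> Q y" "norm (G' y - q) \<le> \<eta>" using G' by blast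
      have "\<eta> \<le> \<epsilon> / 4" by (simp add: \<eta>_def)
      then show ?thesis
        by (intro dual_norm_on_near_less[OF Y(1) _ q(2), where \<kappa> = "\<epsilon> / 4"])
          (use q(1) \<open>\<epsilon> > 0\<close> that in \<open>simp_all add: Q_def\<close>)
    qed
    have "norm (G' z) \<le> (2 + 3 * C + C\<^sup>2) * M" for z
    proof -
      obtain q where q: "norm q \<le> (1 + 3 * C + C\<^sup>2) * M" "norm (G' z - q) \<le> M"
        using G'[of z] unfolding Q_def \<eta>_def by auto
      then have "norm (G' z) \<le> (1 + 3 * C + C\<^sup>2) * M + M"
        using norm_triangle_sub[of "G' z" q] by linarith
      then show ?thesis by (simp add: algebra_simps)
    qed
    moreover have "(2 + 3 * C + C\<^sup>2) * M \<ge> 0"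
      using C M by (simp add: smoothing_constant_def)
    ultimately show "((2 + 3 * C + C\<^sup>2) * M)-lipschitz_on UNIV G"
      using C1_lipschitz_iff[OF G(1)] by blast
  qed
qed

theorem theorem2p4:
  assumes "property_star TYPE('a::banach)"
  shows
   "(\<forall>(Y::'a set) f f' F \<epsilon>.
        subspace Y \<and> closed Y \<and> C1_deriv_on Y f f' \<and> continuous_on UNIV F \<and>
        (\<forall>y\<in>Y. F y = f y) \<and> \<epsilon> > 0 \<longrightarrow>
      (\<exists>G G'. (\<forall>x. (G has_derivative blinfun_apply (G' x)) (at x)) \<and> continuous_on UNIV G' \<and>
         (\<forall>x. \<bar>F x - G x\<bar> < \<epsilon>) \<and>
         (\<forall>y\<in>Y. dual_norm_on Y (\<lambda>v. f' y v - G' y v) < \<epsilon>)))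
    \<and>
    (\<exists>C2::real. \<forall>(Y::'a set) f f' F \<epsilon>.
        subspace Y \<and> closed Y \<and> C1_deriv_on Y f f' \<and> continuous_on UNIV F \<and>
        (\<forall>y\<in>Y. F y = f y) \<and> \<epsilon> > 0 \<and>
        (\<exists>L. L-lipschitz_on Y f) \<and> (\<exists>L. L-lipschitz_on UNIV F) \<longrightarrow>
      (\<exists>G G'. (\<forall>x. (G has_derivative blinfun_apply (G' x)) (at x)) \<and> continuous_on UNIV G' \<and>
         (\<forall>x. \<bar>F x - G x\<bar> < \<epsilon>) \<and>
         (\<forall>y\<in>Y. dual_norm_on Y (\<lambda>v. f' y v - G' y v) < \<epsilon>) \<and>
         (\<forall>L. L-lipschitz_on UNIV F \<longrightarrow> (C2 * L)-lipschitz_on UNIV G)))"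
proof -
  obtain C where C: "smoothing_constant TYPE('a) C"
    using property_star_smoothing_constant[OF assms] .
  then have "C \<ge> 0" by (simp add: smoothing_constant_def)
  show ?thesis
  proof (intro conjI allI impI exI[of _ "2 + 3 * C + C\<^sup>2"], goal_cases)
    case (1 Y f f' F \<epsilon>)
    then obtain G G' where "has_C1_derivative G G'" "\<And>x. \<bar>F x - G x\<bar> < \<epsilon>"
      "\<And>y. y \<in> Y \<Longrightarrow> dual_norm_on Y (\<lambda>v. f' y v - G' y v) < \<epsilon>"
      using C1_fine_approximation_continuous[OF C, of Y f f' F \<epsilon>] by blast
    then show ?case unfolding has_C1_derivative_def by blast
  next
    case (2 Y f f' F \<epsilon>)
    \<comment> \<open>The least Lipschitz constant of \<open>F\<close> is used, so that the bound
      for \<open>G\<close> passes to every larger \<open>L\<close>.\<close>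
    then obtain M where M: "M-lipschitz_on UNIV F" "\<And>L. L-lipschitz_on UNIV F \<Longrightarrow> M \<le> L"
      using lipschitz_on_exact_constant by metis
    obtain G G' where G: "has_C1_derivative G G'" "\<And>x. \<bar>F x - G x\<bar> < \<epsilon>"
      "\<And>y. y \<in> Y \<Longrightarrow> dual_norm_on Y (\<lambda>v. f' y v - G' y v) < \<epsilon>"
      and lip: "((2 + 3 * C + C\<^sup>2) * M)-lipschitz_on UNIV G"
      using C1_fine_approximation_lipschitz[OF C, of Y f f' M F \<epsilon>] 2 M(1) by blast
    have "((2 + 3 * C + C\<^sup>2) * L)-lipschitz_on UNIV G" if "L-lipschitz_on UNIV F" for L
      using M(2)[OF that] \<open>C \<ge> 0\<close> by (intro lipschitz_on_mono[OF lip] mult_left_mono) auto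
    then show ?case using G unfolding has_C1_derivative_def by blast
  qed
qed

end
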